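(* Let $d,r$ be positive integers and let $\mathcal I$ be a Tverberg type with parameters $d,r$, i.e. a partition of $\{1,\dots,T(d,r)\}$ into $r$ parts, where $T(d,r)=(r-1)(d+1)+1$. If $\mathcal I$ is colorful, then the predicate $\neg\mathrm{Tv}_{\mathcal I}$ on $\mathbb R^d$ is avoidable; if $\mathcal I$ is not colorful, then the predicate $\mathrm{Tv}_{\mathcal I}$ on $\mathbb R^d$ is avoidable.
   Context: Predicates. A $k$-ary (geometric) predicate on $\mathbb R^d$ is a property $\Phi$ of $k$-tuples $(p_1,\dots,p_k)\in(\mathbb R^d)^k$. All predicates considered are semialgebraic: $\Phi$ is given by a (fixed) Boolean combination of terms $f(p_1,\dots,p_k)>0$ with $f$ nonzero polynomials (the value of $\Phi$ on tuples at which some of these polynomials vanishes is irrelevant). A finite sequence of points $P$ in $\mathbb R^d$ is $\Phi$-generic if none of these polynomials vanishes on any $k$-tuple of distinct points of $P$. $\Phi$ occurs in $P=(p_1,\dots,p_n)$ if there are indices $i_1<\dots<i_k$ such that $\Phi(p_{i_1},\dots,p_{i_k})$ holds; otherwise $P$ avoids $\Phi$. $\Phi$ is unavoidable if there is $N$ such that $\Phi$ occurs in every $\Phi$-generic sequence of at least $N$ points. Otherwise, i.e. if there exist arbitrarily long ($\Phi$-generic) point sequences avoiding $\Phi$, $\Phi$ is avoidable. Tverberg types. $T(d,r)=(r-1)(d+1)+1$. A Tverberg type (with parameters $d,r$) is a partition $\mathcal I=\{I_1,\dots,I_r\}$ of $\{1,\dots,T(d,r)\}$ into $r$ (nonempty)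 parts. $\mathrm{Tv}_{\mathcal I}$ is the $T(d,r)$-ary predicate on $\mathbb R^d$ that holds for $(p_1,\dots,p_{T(d,r)})$ iff the $r$ convex hulls $\mathrm{conv}\{p_i : i\in I_j\}$, $1\le j\le r$, have a common point. $\mathcal I$ is colorful if for each $1\le i\le d+1$ the $r$ consecutive integers $(r-1)(i-1)+1,\dots,(r-1)i+1$ belong one to each of the $r$ parts $I_1,\dots,I_r$. *)

theory Defs
  imports "HOL-Analysis.Analysis" "HOL-Library.Disjoint_Sets"
begin

text \<open>
  A \<open>k\<close>-tuple of points of \<open>\<real>\<^sup>d\<close> is a function \<open>p :: nat \<Rightarrow> real ^ 'n\<close>, where \<open>d = CARD('n)\<close>, of which
  only the values \<open>p 1, \<dots>, p k\<close> matter. A sequence of \<open>n\<close> points is such a function read on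
  \<open>{1..n}\<close>.
\<close>

text \<open>
  Polynomials in the \<open>d * k\<close> coordinates of \<open>p 1, \<dots>, p k\<close>. Over the reals a polynomial is determined
  by its polynomial function, and it is nonzero iff the function is not identically zero. The
  library's \<open>real_polynomial_function\<close> needs a normed space as its domain, which the type of tuples
  is not.
\<close>

inductive tuple_polynomial :: "nat \<Rightarrow> ((nat \<Rightarrow> real ^ 'n) \<Rightarrow> real) \<Rightarrow> bool" for k where
  const: "tuple_polynomial k (\<lambda>p. c)"
| coord: "i \<in> {1..k} \<Longrightarrow> tuple_polynomial k (\<lambda>p. p i $ j)"
| add: "tuple_polynomial k f \<Longrightarrow> tuple_polynomial k g \<Longrightarrow> tuple_polynomial k (\<lambda>p. f p + g p)"
| mult: "tuple_polynomial k f \<Longrightarrow> tuple_polynomial k g \<Longrightarrow> tuple_polynomial k (\<lambda>p. f p * g p)"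

datatype (atoms: 'f) bool_comb =
    Positive 'f
  | Neg "'f bool_comb"
  | Conj "'f bool_comb" "'f bool_comb"
  | Disj "'f bool_comb" "'f bool_comb"

primrec holds :: "('t \<Rightarrow> real) bool_comb \<Rightarrow> 't \<Rightarrow> bool" where
  "holds (Positive f) p \<longleftrightarrow> f p > 0"
| "holds (Neg a) p \<longleftrightarrow> \<not> holds a p"
| "holds (Conj a b) p \<longleftrightarrow> holds a p \<and> holds b p"
| "holds (Disj a b) p \<longleftrightarrow> holds a p \<or> holds b p"

text \<open>The value of \<open>\<Phi>\<close> at tuples where one of the polynomials vanishes is irrelevant.\<close>

definition given_by ::
    "nat \<Rightarrow> ((nat \<Rightarrow> real ^ 'n) \<Rightarrow> real) bool_comb \<Rightarrow> ((nat \<Rightarrow> real ^ 'n) \<Rightarrow> bool) \<Rightarrow> bool" where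
  "given_by k b \<Phi> \<longleftrightarrow>
     (\<forall>f\<in>atoms b. tuple_polynomial k f \<and> f \<noteq> (\<lambda>p. 0)) \<and>
     (\<forall>p. (\<forall>f\<in>atoms b. f p \<noteq> 0) \<longrightarrow> (\<Phi> p \<longleftrightarrow> holds b p))"

definition semialgebraic :: "nat \<Rightarrow> ((nat \<Rightarrow> real ^ 'n) \<Rightarrow> bool) \<Rightarrow> bool" where
  "semialgebraic k \<Phi> \<longleftrightarrow> (\<exists>b. given_by k b \<Phi>)"

text \<open>
  ``Distinct points'' of a sequence are points with distinct indices, taken in any order. (If
  distinctness meant distinct values, a constant sequence would be generic for trivial reasons.)
\<close>

definition generic ::
    "nat \<Rightarrow> ((nat \<Rightarrow> real ^ 'n) \<Rightarrow> real) bool_comb \<Rightarrow> nat \<Rightarrow> (nat \<Rightarrow> real ^ 'n) \<Rightarrow> bool" where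
  "generic k b n P \<longleftrightarrow>
     (\<forall>s. inj_on s {1..k} \<and> s ` {1..k} \<subseteq> {1..n} \<longrightarrow> (\<forall>f\<in>atoms b. f (P \<circ> s) \<noteq> 0))"

definition occurs ::
    "nat \<Rightarrow> ((nat \<Rightarrow> real ^ 'n) \<Rightarrow> bool) \<Rightarrow> nat \<Rightarrow> (nat \<Rightarrow> real ^ 'n) \<Rightarrow> bool" where
  "occurs k \<Phi> n P \<longleftrightarrow>
     (\<exists>s. strict_mono_on {1..k} s \<and> s ` {1..k} \<subseteq> {1..n} \<and> \<Phi> (P \<circ> s))"

text \<open>Unavoidability of \<open>\<Phi>\<close> with respect to a fixed Boolean combination \<open>b\<close> that gives \<open>\<Phi>\<close>.\<close>

definition unavoidable_wrt ::
    "nat \<Rightarrow> ((nat \<Rightarrow> real ^ 'n) \<Rightarrow> real) bool_comb \<Rightarrow> ((nat \<Rightarrow> real ^ 'n) \<Rightarrow> bool) \<Rightarrow> bool" where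
  "unavoidable_wrt k b \<Phi> \<longleftrightarrow> (\<exists>N. \<forall>n\<ge>N. \<forall>P. generic k b n P \<longrightarrow> occurs k \<Phi> n P)"

text \<open>
  For predicates such as the Tverberg ones, which are described geometrically, no particular Boolean
  combination is singled out. Avoidability is therefore required for every choice of it, and there
  has to be at least one.
\<close>

definition avoidable :: "nat \<Rightarrow> ((nat \<Rightarrow> real ^ 'n) \<Rightarrow> bool) \<Rightarrow> bool" where
  "avoidable k \<Phi> \<longleftrightarrow>
     semialgebraic k \<Phi> \<and> (\<forall>b. given_by k b \<Phi> \<longrightarrow> \<not> unavoidable_wrt k b \<Phi>)"

definition tverberg_number :: "nat \<Rightarrow> nat \<Rightarrow> nat" where
  "tverberg_number d r = (r - 1) * (d + 1) + 1"

definition tverberg_type :: "nat \<Rightarrow> nat \<Rightarrow> nat set set \<Rightarrow> bool" where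
  "tverberg_type d r \<I> \<longleftrightarrow> partition_on {1..tverberg_number d r} \<I> \<and> card \<I> = r"

definition Tv :: "nat set set \<Rightarrow> (nat \<Rightarrow> real ^ 'n) \<Rightarrow> bool" where
  "Tv \<I> p \<longleftrightarrow> (\<Inter>J\<in>\<I>. convex hull (p ` J)) \<noteq> {}"

definition colorful :: "nat \<Rightarrow> nat \<Rightarrow> nat set set \<Rightarrow> bool" where
  "colorful d r \<I> \<longleftrightarrow>
     (\<forall>i\<in>{1..d+1}. \<forall>J\<in>\<I>. \<exists>!m. m \<in> {(r - 1) * (i - 1) + 1..(r - 1) * i + 1} \<and> m \<in> J)"

end

theory Submission
  imports Defs
begin

text \<open>
  A common point of the hulls amounts to a solution \<open>\<alpha> \<ge> 0\<close>, \<open>\<alpha> \<noteq> 0\<close>, of the linear equations saying that \<open>\<Sum>i\<in>J. \<alpha> i * x i k\<close> does not depend on the part \<open>J\<close>, where \<open>x i 0 = 1\<close> and \<open>x i k\<close> is the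
  \<open>k\<close>-th coordinate of the \<open>i\<close>-th point. Take points whose ratios \<open>x i (k + 1) / x i k\<close> grow quickly with
  \<open>i\<close>. Then in each such sum a single term dominates, and comparing the dominating terms shows that a
  solution exists iff the type is colorful. The coordinates of these points can be chosen one after the
  other, each only subject to being large, so finitely many nonzero polynomials can be kept from
  vanishing. That the Tverberg predicates are semialgebraic follows by Fourier--Motzkin elimination
  with polynomial coefficients.
\<close>

section \<open>Semialgebraic predicates\<close>

text \<open>\<open>avoidable\<close> asks for avoiding sequences that are generic for every Boolean
  combination giving the predicate, so a sequence can only be built once the polynomials are known.
  One construction serves both halves of the theorem: growth passes to subsequences, hence on all
  increasing \<open>T\<close>-tuples of the sequence the Tverberg predicate has the same value,
  namely whether the type is colorful. For a colorful type the obstacle is nonnegativity: counting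
  equations yields a nonzero solution but says nothing about signs. Dividing it by an explicit
  positive approximate solution gives quotients that differ so little from each other that they
  share a sign.\<close>

lemma finite_atoms: "finite (atoms b)"
  by (induction b) auto

lemma tuple_polynomial_uminus:
  assumes "tuple_polynomial k f"
  shows "tuple_polynomial k (\<lambda>p. - f p)"
  using tuple_polynomial.mult[OF tuple_polynomial.const[of k "-1"] assms] by simp

lemma tuple_polynomial_diff:
  assumes "tuple_polynomial k f" "tuple_polynomial k g"
  shows "tuple_polynomial k (\<lambda>p. f p - g p)"
  using tuple_polynomial.add[OF assms(1) tuple_polynomial_uminus[OF assms(2)]] by simp

lemma tuple_polynomial_cong:
  assumes "tuple_polynomial k f" "\<And>i. i \<in> {1..k} \<Longrightarrow> p i = q i"
  shows "f p = f q"
  using assms by (induction rule: tuple_polynomial.induct) auto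

text \<open>Applied to curves that vary a single real coordinate, where nonvanishing only means
  avoiding the roots of a univariate polynomial.\<close>

lemma tuple_polynomial_along_curve:
  assumes "tuple_polynomial k f"
    and "\<And>i j. i \<in> {1..k} \<Longrightarrow> \<exists>q. \<forall>t. A t i $ j = poly q t"
  shows "\<exists>q. \<forall>t. f (A t) = poly q t"
  using assms(1)
proof induction
  case (const c)
  show ?case by (rule exI[of _ "[:c:]"]) simp
next
  case (add f g)
  then show ?case by (metis poly_add)
next
  case (mult f g)
  then show ?case by (metis poly_mult)
qed (use assms(2) in blast)

lemma semialgebraic_positive:
  assumes "tuple_polynomial k f"
  shows "semialgebraic k (\<lambda>p. f p > 0)"
proof (cases "f = (\<lambda>p. 0)")
  case True
  \<comment> \<open>The zero polynomial is not allowed as an atom. The predicate is then always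
    false, and so is the one with atom \<open>-1\<close>.\<close>
  have "given_by k (Positive (\<lambda>p. -1)) (\<lambda>p. f p > 0)"
    using True by (auto simp: given_by_def fun_eq_iff intro: tuple_polynomial.const)
  then show ?thesis unfolding semialgebraic_def by blast
next
  case False
  then have "given_by k (Positive f) (\<lambda>p. f p > 0)"
    using assms by (auto simp: given_by_def)
  then show ?thesis unfolding semialgebraic_def by blast
qed

lemma semialgebraic_not:
  assumes "semialgebraic k \<Phi>"
  shows "semialgebraic k (\<lambda>p. \<not> \<Phi> p)"
proof -
  obtain b where "given_by k b \<Phi>"
    using assms unfolding semialgebraic_def by blast
  then have "given_by k (Neg b) (\<lambda>p. \<not> \<Phi> p)" by (auto simp: given_by_def)
  then show ?thesis unfolding semialgebraic_def by blast
qed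

lemma semialgebraic_conj:
  assumes "semialgebraic k \<Phi>" "semialgebraic k \<Psi>"
  shows "semialgebraic k (\<lambda>p. \<Phi> p \<and> \<Psi> p)"
proof -
  obtain a b where "given_by k a \<Phi>" "given_by k b \<Psi>"
    using assms unfolding semialgebraic_def by blast
  then have "given_by k (Conj a b) (\<lambda>p. \<Phi> p \<and> \<Psi> p)" by (auto simp: given_by_def)
  then show ?thesis unfolding semialgebraic_def by blast
qed

lemma semialgebraic_True: "semialgebraic k (\<lambda>p. True)"
  using semialgebraic_positive[OF tuple_polynomial.const[of k 1]] by simp

lemma semialgebraic_Ball:
  assumes "finite S" "\<And>c. c \<in> S \<Longrightarrow> semialgebraic k (\<Phi> c)"
  shows "semialgebraic k (\<lambda>p. \<forall>c\<in>S. \<Phi> c p)"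
  using assms
proof (induction rule: finite_induct)
  case empty
  show ?case using semialgebraic_True by simp
next
  case (insert c S)
  then show ?case using semialgebraic_conj[of k "\<Phi> c" "\<lambda>p. \<forall>c\<in>S. \<Phi> c p"] by simp
qed

lemma semialgebraic_Bex:
  assumes "finite S" "\<And>c. c \<in> S \<Longrightarrow> semialgebraic k (\<Phi> c)"
  shows "semialgebraic k (\<lambda>p. \<exists>c\<in>S. \<Phi> c p)"
  using semialgebraic_not[OF semialgebraic_Ball[of S k "\<lambda>c p. \<not> \<Phi> c p"]]
    assms semialgebraic_not by auto

lemma semialgebraic_nonneg:
  assumes "tuple_polynomial k f"
  shows "semialgebraic k (\<lambda>p. f p \<ge> 0)"
  using semialgebraic_not[OF semialgebraic_positive[OF tuple_polynomial_uminus[OF assms]]]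
  by (simp add: not_less)

lemma semialgebraic_zero:
  assumes "tuple_polynomial k f"
  shows "semialgebraic k (\<lambda>p. f p = 0)"
  using semialgebraic_conj[OF semialgebraic_nonneg[OF assms]
      semialgebraic_nonneg[OF tuple_polynomial_uminus[OF assms]]]
  by (simp add: order.eq_iff conj_commute)

section \<open>Elimination of unknowns from linear inequalities\<close>

text \<open>A solution \<open>t\<close> exists iff every lower bound \<open>- A c / B c\<close> is
  at most every upper bound. The comparison is cross-multiplied, so that it stays polynomial in
  \<open>A\<close> and \<open>B\<close>.\<close>

lemma fourier_motzkin:
  fixes A B :: "'c \<Rightarrow> real"
  assumes "finite C"
  shows "(\<exists>t. \<forall>c\<in>C. A c + B c * t \<ge> 0) \<longleftrightarrow>
    (\<forall>c\<in>C. B c = 0 \<longrightarrow> A c \<ge> 0) \<and>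
    (\<forall>c\<in>C. \<forall>c'\<in>C. B c > 0 \<longrightarrow> B c' < 0 \<longrightarrow> B c * A c' - B c' * A c \<ge> 0)"
    (is "?L \<longleftrightarrow> ?R1 \<and> ?R2")
proof
  assume ?L
  then obtain t where t: "\<And>c. c \<in> C \<Longrightarrow> A c + B c * t \<ge> 0" by blast
  have ?R1 using t by fastforce
  moreover have ?R2
  proof (intro ballI impI)
    fix c c' assume c: "c \<in> C" "c' \<in> C" "B c > 0" "B c' < 0"
    have "B c * (A c' + B c' * t) \<ge> 0" "- B c' * (A c + B c * t) \<ge> 0"
      using t c by (simp_all add: mult_nonneg_nonneg mult_nonpos_nonneg)
    then show "B c * A c' - B c' * A c \<ge> 0" by (simp add: algebra_simps)
  qed
  ultimately show "?R1 \<and> ?R2" ..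
next
  assume R: "?R1 \<and> ?R2"
  let ?lo = "(\<lambda>c. - A c / B c) ` {c \<in> C. B c > 0}" and ?hi = "(\<lambda>c. - A c / B c) ` {c \<in> C. B c < 0}"
  have fin: "finite ?lo" "finite ?hi" using assms by auto
  have le: "x \<le> y" if xy: "x \<in> ?lo" "y \<in> ?hi" for x y
  proof -
    obtain c c' where c: "c \<in> C" "B c > 0" "x = - A c / B c" "c' \<in> C" "B c' < 0" "y = - A c' / B c'"
      using xy by auto
    then have "B c * A c' - B c' * A c \<ge> 0" using R by blast
    then have "B c' * A c / (B c * B c') \<ge> B c * A c' / (B c * B c')"
      using c by (intro divide_right_mono_neg) (auto intro: mult_nonneg_nonpos)
    then show "x \<le> y" using c by simp
  qed
  obtain t where t: "\<forall>x\<in>?lo. x \<le> t" "\<forall>y\<in>?hi. t \<le> y"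
  proof (cases "?lo = {}")
    case lo: True
    show ?thesis
    proof (cases "?hi = {}")
      case True
      then show ?thesis using lo that[of 0] by blast
    next
      case False
      show ?thesis
      proof (rule that)
        show "\<forall>x\<in>?lo. x \<le> Min ?hi" unfolding lo by blast
        show "\<forall>y\<in>?hi. Min ?hi \<le> y" using fin Min_le by blast
      qed
    qed
  next
    case False
    show ?thesis
    proof (rule that)
      show "\<forall>x\<in>?lo. x \<le> Max ?lo" using fin Max_ge by blast
      show "\<forall>y\<in>?hi. Max ?lo \<le> y" using fin le Max_in[OF fin(1) False] by blast
    qed
  qed
  have "A c + B c * t \<ge> 0" if c: "c \<in> C" for c
  proof -
    consider "B c = 0" | "B c > 0" | "B c < 0" by linarith
    then show ?thesis
    proof cases
      case 1
      then show ?thesis using R c by auto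
    next
      case 2
      then have "- A c / B c \<le> t" using t c by blast
      then show ?thesis using 2 by (simp add: field_simps)
    next
      case 3
      then have "t \<le> - A c / B c" using t c by blast
      then show ?thesis using 3 by (simp add: field_simps)
    qed
  qed
  then show ?L by blast
qed

text \<open>The last unknown is eliminated by \<open>fourier_motzkin\<close>. Fixing
  \<open>x 0 = 1\<close> lets \<open>c 0 p\<close> be the constant term of an inequality, so that
  affine systems are covered.\<close>

lemma semialgebraic_linear_feasible:
  fixes C :: "(nat \<Rightarrow> (nat \<Rightarrow> real ^ 'n) \<Rightarrow> real) set"
  assumes "finite C" "\<And>c j. c \<in> C \<Longrightarrow> j \<le> m \<Longrightarrow> tuple_polynomial k (c j)"
  shows "semialgebraic k (\<lambda>p. \<exists>x. x 0 = 1 \<and> (\<forall>c\<in>C. (\<Sum>j\<le>m. c j p * x j) \<ge> 0))"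
  using assms
proof (induction m arbitrary: C)
  case 0
  have "semialgebraic k (\<lambda>p. \<forall>c\<in>C. c 0 p \<ge> 0)"
    using 0 by (intro semialgebraic_Ball semialgebraic_nonneg) auto
  moreover have "(\<exists>x. x 0 = 1 \<and> (\<forall>c\<in>C. (\<Sum>j\<le>0. c j p * x j) \<ge> 0)) \<longleftrightarrow> (\<forall>c\<in>C. c 0 p \<ge> 0)" for p
    by (auto intro!: exI[of _ "\<lambda>_. 1 :: real"])
  ultimately show ?case by presburger
next
  case (Suc m)
  define M where "M = Suc m"
  define comb :: "(nat \<Rightarrow> (nat \<Rightarrow> real ^ 'n) \<Rightarrow> real) \<Rightarrow> (nat \<Rightarrow> (nat \<Rightarrow> real ^ 'n) \<Rightarrow> real) \<Rightarrow> _"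
    where "comb = (\<lambda>c c' j p. c M p * c' j p - c' M p * c j p)"
  define elim where "elim = (\<lambda>S S'. (C - S - S') \<union> (\<lambda>(c, c'). comb c c') ` (S \<times> S'))"
  define feas where "feas = (\<lambda>m (C :: (nat \<Rightarrow> (nat \<Rightarrow> real ^ 'n) \<Rightarrow> real) set) p. \<exists>x::nat \<Rightarrow> real. x 0 = 1 \<and> (\<forall>c\<in>C. (\<Sum>j\<le>m. c j p * x j) \<ge> 0))"
  define pat where "pat = (\<lambda>S S' p. (\<forall>c\<in>S. c M p > 0) \<and> (\<forall>c\<in>S'. - c M p > 0) \<and> (\<forall>c\<in>C - S - S'. c M p = 0))"
  have step: "feas M C p \<longleftrightarrow> feas m (elim {c \<in> C. c M p > 0} {c \<in> C. c M p < 0}) p" for p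
  proof -
    have "feas M C p \<longleftrightarrow> (\<exists>x::nat \<Rightarrow> real. x 0 = 1 \<and> (\<exists>t. \<forall>c\<in>C. (\<Sum>j\<le>m. c j p * x j) + c M p * t \<ge> 0))"
    proof
      assume "feas M C p"
      then show "\<exists>x::nat \<Rightarrow> real. x 0 = 1 \<and> (\<exists>t. \<forall>c\<in>C. (\<Sum>j\<le>m. c j p * x j) + c M p * t \<ge> 0)"
        unfolding feas_def M_def by auto
    next
      assume "\<exists>x::nat \<Rightarrow> real. x 0 = 1 \<and> (\<exists>t. \<forall>c\<in>C. (\<Sum>j\<le>m. c j p * x j) + c M p * t \<ge> 0)"
      then obtain x :: "nat \<Rightarrow> real" and t where
        x: "x 0 = 1" "\<forall>c\<in>C. (\<Sum>j\<le>m. c j p * x j) + c M p * t \<ge> 0" by blast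
      then show "feas M C p"
        unfolding feas_def M_def by (intro exI[of _ "x(Suc m := t)"]) auto
    qed
    also have "\<dots> \<longleftrightarrow> (\<exists>x::nat \<Rightarrow> real. x 0 = 1 \<and> (\<forall>c\<in>C. c M p = 0 \<longrightarrow> (\<Sum>j\<le>m. c j p * x j) \<ge> 0) \<and>
        (\<forall>c\<in>C. \<forall>c'\<in>C. c M p > 0 \<longrightarrow> c' M p < 0 \<longrightarrow> (\<Sum>j\<le>m. comb c c' j p * x j) \<ge> 0))"
    proof (intro ex_cong1 conj_cong refl)
      fix x :: "nat \<Rightarrow> real"
      have "(\<Sum>j\<le>m. comb c c' j p * x j) =
          c M p * (\<Sum>j\<le>m. c' j p * x j) - c' M p * (\<Sum>j\<le>m. c j p * x j)" for c c'
        unfolding comb_def sum_distrib_left sum_subtractf[symmetric]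
        by (intro sum.cong) (simp_all add: algebra_simps)
      then show "(\<exists>t. \<forall>c\<in>C. (\<Sum>j\<le>m. c j p * x j) + c M p * t \<ge> 0) \<longleftrightarrow>
        (\<forall>c\<in>C. c M p = 0 \<longrightarrow> (\<Sum>j\<le>m. c j p * x j) \<ge> 0) \<and>
        (\<forall>c\<in>C. \<forall>c'\<in>C. c M p > 0 \<longrightarrow> c' M p < 0 \<longrightarrow> (\<Sum>j\<le>m. comb c c' j p * x j) \<ge> 0)"
        using fourier_motzkin[OF Suc.prems(1), of "\<lambda>c. \<Sum>j\<le>m. c j p * x j" "\<lambda>c. c M p"] by simp
    qed
    also have "\<dots> \<longleftrightarrow> feas m (elim {c \<in> C. c M p > 0} {c \<in> C. c M p < 0}) p"
      unfolding feas_def elim_def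
    proof (intro ex_cong1 conj_cong refl)
      fix x :: "nat \<Rightarrow> real"
      have "C - {c \<in> C. c M p > 0} - {c \<in> C. c M p < 0} = {c \<in> C. c M p = 0}"
        by (simp add: set_eq_iff order.eq_iff not_less conj_ac)
      then show "(\<forall>c\<in>C. c M p = 0 \<longrightarrow> (\<Sum>j\<le>m. c j p * x j) \<ge> 0) \<and>
        (\<forall>c\<in>C. \<forall>c'\<in>C. c M p > 0 \<longrightarrow> c' M p < 0 \<longrightarrow> (\<Sum>j\<le>m. comb c c' j p * x j) \<ge> 0) \<longleftrightarrow>
        (\<forall>c\<in>C - {c \<in> C. c M p > 0} - {c \<in> C. c M p < 0} \<union>
          (\<lambda>(c, c'). comb c c') ` ({c \<in> C. c M p > 0} \<times> {c \<in> C. c M p < 0}). (\<Sum>j\<le>m. c j p * x j) \<ge> 0)"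
        by (simp add: ball_Un) (simp add: Ball_def imp_conjL)
    qed
    finally show ?thesis .
  qed
  have pat_unique: "S = {c \<in> C. c M p > 0} \<and> S' = {c \<in> C. c M p < 0}"
    if S: "S \<subseteq> C" "S' \<subseteq> C" and pat: "pat S S' p" for S S' p
  proof -
    have pos: "\<forall>c\<in>S. c M p > 0" and neg: "\<forall>c\<in>S'. - c M p > 0" and zero: "\<forall>c\<in>C - S - S'. c M p = 0"
      using pat unfolding pat_def by simp_all
    have "(c \<in> S \<longleftrightarrow> c \<in> C \<and> c M p > 0) \<and> (c \<in> S' \<longleftrightarrow> c \<in> C \<and> c M p < 0)" for c
      using bspec[OF pos, of c] bspec[OF neg, of c] bspec[OF zero, of c]
        subsetD[OF S(1), of c] subsetD[OF S(2), of c]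
      by (cases "c \<in> S"; cases "c \<in> S'"; cases "c \<in> C") simp_all
    then show ?thesis by (simp add: set_eq_iff)
  qed
  \<comment> \<open>Which inequalities have to be combined depends on the signs of
    \<open>c M p\<close>, hence on \<open>p\<close>. Guessing the sign pattern \<open>S\<close>,
    \<open>S'\<close> makes \<open>elim S S'\<close> a system independent of \<open>p\<close>, to
    which the induction hypothesis applies.\<close>
  have "feas M C p \<longleftrightarrow> (\<exists>S\<in>Pow C. \<exists>S'\<in>Pow C. pat S S' p \<and> feas m (elim S S') p)" for p
  proof
    assume "feas M C p"
    moreover have "pat {c \<in> C. c M p > 0} {c \<in> C. c M p < 0} p"
      unfolding pat_def by (simp add: order.eq_iff not_less)
    moreover have "{c \<in> C. c M p > 0} \<in> Pow C" "{c \<in> C. c M p < 0} \<in> Pow C"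
      by (simp_all only: Pow_iff Collect_subset Collect_restrict)
    ultimately show "\<exists>S\<in>Pow C. \<exists>S'\<in>Pow C. pat S S' p \<and> feas m (elim S S') p"
      unfolding step by (intro bexI conjI)
  next
    assume "\<exists>S\<in>Pow C. \<exists>S'\<in>Pow C. pat S S' p \<and> feas m (elim S S') p"
    then obtain S S' where S: "S \<subseteq> C" "S' \<subseteq> C" "pat S S' p" and "feas m (elim S S') p"
      by (elim bexE conjE PowD[elim_format])
    then show "feas M C p" unfolding step using pat_unique[OF S] by simp
  qed
  then have "feas M C = (\<lambda>p. \<exists>S\<in>Pow C. \<exists>S'\<in>Pow C. pat S S' p \<and> feas m (elim S S') p)"
    by (rule ext)
  moreover have "semialgebraic k (\<lambda>p. \<exists>S\<in>Pow C. \<exists>S'\<in>Pow C. pat S S' p \<and> feas m (elim S S') p)"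
  proof (intro semialgebraic_Bex semialgebraic_conj)
    fix S S' assume S: "S \<in> Pow C" "S' \<in> Pow C"
    have pol: "tuple_polynomial k (c j)" if "c \<in> C" "j \<le> M" for c j
      using Suc.prems(2) that M_def by auto
    show "semialgebraic k (pat S S')"
      unfolding pat_def
      using S pol Suc.prems(1) finite_subset[of _ C]
      by (intro semialgebraic_conj semialgebraic_Ball semialgebraic_positive semialgebraic_zero
          tuple_polynomial_uminus) auto
    show "semialgebraic k (feas m (elim S S'))"
      unfolding feas_def
    proof (rule Suc.IH)
      show "finite (elim S S')"
        using S Suc.prems(1) finite_subset[of _ C] unfolding elim_def by auto
      show "tuple_polynomial k (c j)" if c: "c \<in> elim S S'" and "j \<le> m" for c j
      proof -
        consider "c \<in> C" | a b where "a \<in> S" "b \<in> S'" "c = comb a b"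
          using c unfolding elim_def by auto
        then show ?thesis
        proof cases
          case 1
          then show ?thesis using pol that M_def by simp
        next
          case 2
          then have "tuple_polynomial k (a M)" "tuple_polynomial k (b M)"
            "tuple_polynomial k (a j)" "tuple_polynomial k (b j)"
            using pol that M_def S by auto
          then show ?thesis
            unfolding 2(3) comb_def by (intro tuple_polynomial_diff tuple_polynomial.mult)
        qed
      qed
    qed
  qed (use Suc.prems(1) in auto)
  ultimately have "semialgebraic k (feas M C)" by simp
  then show ?case unfolding feas_def M_def .
qed

section \<open>Tverberg predicates as linear systems\<close>

text \<open>The weights belong to indices and not to points, so \<open>p\<close> may repeat
  points.\<close>

lemma convex_hull_image_finite:
  fixes p :: "'i \<Rightarrow> 'a::real_vector"
  assumes "finite J"
  shows "convex hull (p ` J) = {\<Sum>i\<in>J. \<alpha> i *\<^sub>R p i |\<alpha>. (\<forall>i\<in>J. 0 \<le> \<alpha> i) \<and> sum \<alpha> J = 1}" (is "_ = ?R")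
proof
  show "convex hull (p ` J) \<subseteq> ?R"
  proof (rule hull_minimal)
    show "p ` J \<subseteq> ?R"
    proof
      fix y assume "y \<in> p ` J"
      then obtain j where j: "j \<in> J" "y = p j" by auto
      have "(\<Sum>i\<in>J. of_bool (i = j) *\<^sub>R p i) = (\<Sum>i\<in>J. if i = j then p i else 0)"
        by (intro sum.cong) auto
      also have "\<dots> = y" using j assms by simp
      moreover have "sum (\<lambda>i. of_bool (i = j) :: real) J = 1"
        using j assms by (simp add: of_bool_def)
      ultimately show "y \<in> ?R" by (intro CollectI exI[of _ "\<lambda>i. of_bool (i = j)"]) auto
    qed
    show "convex ?R"
    proof (rule convexI)
      fix x y and u v :: real
      assume "x \<in> ?R" "y \<in> ?R" and uv: "0 \<le> u" "0 \<le> v" "u + v = 1"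
      then obtain a b where
        a: "x = (\<Sum>i\<in>J. a i *\<^sub>R p i)" "\<forall>i\<in>J. 0 \<le> a i" "sum a J = 1" and
        b: "y = (\<Sum>i\<in>J. b i *\<^sub>R p i)" "\<forall>i\<in>J. 0 \<le> b i" "sum b J = 1" by auto
      show "u *\<^sub>R x + v *\<^sub>R y \<in> ?R"
      proof (intro CollectI exI conjI ballI)
        show "u *\<^sub>R x + v *\<^sub>R y = (\<Sum>i\<in>J. (u * a i + v * b i) *\<^sub>R p i)"
          unfolding a(1) b(1) by (simp add: scaleR_left_distrib sum.distrib scaleR_sum_right)
        show "0 \<le> u * a i + v * b i" if "i \<in> J" for i using a b uv that by simp
        have "(\<Sum>i\<in>J. u * a i + v * b i) = u * sum a J + v * sum b J"
          by (simp only: sum.distrib sum_distrib_left)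
        then show "(\<Sum>i\<in>J. u * a i + v * b i) = 1" using a b uv by simp
      qed
    qed
  qed
  show "?R \<subseteq> convex hull (p ` J)"
  proof clarify
    fix \<alpha> :: "'i \<Rightarrow> real" assume "\<forall>i\<in>J. 0 \<le> \<alpha> i" "sum \<alpha> J = 1"
    then show "(\<Sum>i\<in>J. \<alpha> i *\<^sub>R p i) \<in> convex hull (p ` J)"
      by (intro convex_sum[OF assms convex_convex_hull]) (auto intro: hull_inc)
  qed
qed

text \<open>As the parts are disjoint, their weights merge into one function
  \<open>\<alpha>\<close>. Comparing the parts pairwise removes the common point, so that the
  weights are the only unknowns.\<close>

lemma Tv_iff:
  assumes disj: "disjoint \<I>" and fin: "\<And>J. J \<in> \<I> \<Longrightarrow> finite J" and ne: "\<I> \<noteq> {}"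
  shows "Tv \<I> p \<longleftrightarrow> (\<exists>\<alpha>. (\<forall>i\<in>\<Union>\<I>. 0 \<le> \<alpha> i) \<and> (\<forall>J\<in>\<I>. sum \<alpha> J = 1) \<and>
     (\<forall>J\<in>\<I>. \<forall>J'\<in>\<I>. (\<Sum>i\<in>J. \<alpha> i *\<^sub>R p i) = (\<Sum>i\<in>J'. \<alpha> i *\<^sub>R p i)))"
    (is "_ \<longleftrightarrow> (\<exists>\<alpha>. ?Q \<alpha>)")
proof
  assume "Tv \<I> p"
  then obtain y where y: "\<And>J. J \<in> \<I> \<Longrightarrow> y \<in> convex hull (p ` J)"
    unfolding Tv_def by blast
  have "\<forall>J\<in>\<I>. \<exists>a. y = (\<Sum>i\<in>J. a i *\<^sub>R p i) \<and> (\<forall>i\<in>J. 0 \<le> a i) \<and> sum a J = 1"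
  proof
    fix J assume "J \<in> \<I>"
    then show "\<exists>a. y = (\<Sum>i\<in>J. a i *\<^sub>R p i) \<and> (\<forall>i\<in>J. 0 \<le> a i) \<and> sum a J = 1"
      using y[of J] by (simp add: convex_hull_image_finite fin)
  qed
  then obtain a where a: "\<forall>J\<in>\<I>. y = (\<Sum>i\<in>J. a J i *\<^sub>R p i) \<and> (\<forall>i\<in>J. 0 \<le> a J i) \<and> sum (a J) J = 1"
    unfolding bchoice_iff ..
  define \<alpha> where "\<alpha> i = a (THE J. J \<in> \<I> \<and> i \<in> J) i" for i
  have eq: "\<alpha> i = a J i" if "J \<in> \<I>" "i \<in> J" for i J
  proof -
    have "(THE J. J \<in> \<I> \<and> i \<in> J) = J"
      using that disj by (intro the_equality) (auto simp: disjoint_def)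
    then show ?thesis by (simp add: \<alpha>_def)
  qed
  have "sum \<alpha> J = 1 \<and> (\<Sum>i\<in>J. \<alpha> i *\<^sub>R p i) = y \<and> (\<forall>i\<in>J. 0 \<le> \<alpha> i)" if "J \<in> \<I>" for J
    using bspec[OF a that] eq[OF that] by simp
  then have "?Q \<alpha>" by (simp add: Ball_def) blast
  then show "\<exists>\<alpha>. ?Q \<alpha>" by (intro exI[of _ \<alpha>])
next
  assume "\<exists>\<alpha>. ?Q \<alpha>"
  then obtain \<alpha> where \<alpha>: "?Q \<alpha>" by (rule exE)
  obtain K where K: "K \<in> \<I>" using ne by blast
  have "(\<Sum>i\<in>K. \<alpha> i *\<^sub>R p i) \<in> convex hull (p ` J)" if J: "J \<in> \<I>" for J
    unfolding convex_hull_image_finite[OF fin[OF J]]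
    using \<alpha> J K by (intro CollectI exI[of _ \<alpha>] conjI) (blast, blast, blast)
  then show "Tv \<I> p" unfolding Tv_def by blast
qed

lemma semialgebraic_Tv:
  fixes \<I> :: "nat set set"
  assumes part: "partition_on {1..T} \<I>" and ne: "\<I> \<noteq> {}"
  shows "semialgebraic T (Tv \<I> :: (nat \<Rightarrow> real ^ 'n::finite) \<Rightarrow> bool)"
proof -
  have disj: "disjoint \<I>" and un: "\<Union>\<I> = {1..T}" and finI: "finite \<I>"
    using part finite_elements[OF _ part] by (auto simp: partition_on_def)
  have sub: "J \<subseteq> {1..T}" if "J \<in> \<I>" for J using un that by blast
  have fin: "finite J" if "J \<in> \<I>" for J using sub[OF that] finite_subset by blast
  \<comment> \<open>Unknown 0 is the constant 1 and unknowns 1 to \<open>T\<close> are the weights.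
    Each equation is split into two inequalities: \<open>up\<close> together with its negation, and
    \<open>eq\<close> for both orders of a pair of parts.\<close>
  define pos :: "nat \<Rightarrow> nat \<Rightarrow> (nat \<Rightarrow> real ^ 'n) \<Rightarrow> real" where "pos = (\<lambda>i l p. of_bool (l = i))"
  define up :: "nat set \<Rightarrow> nat \<Rightarrow> (nat \<Rightarrow> real ^ 'n) \<Rightarrow> real"
    where "up = (\<lambda>J l p. of_bool (l \<in> J) - of_bool (l = 0))"
  \<comment> \<open>The case \<open>l = 0\<close> is separate because \<open>p 0\<close> is not part
    of the tuple, so its coordinates are no \<open>tuple_polynomial\<close>.\<close>
  define eq :: "nat set \<times> nat set \<times> 'n \<Rightarrow> nat \<Rightarrow> (nat \<Rightarrow> real ^ 'n) \<Rightarrow> real"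
    where "eq = (\<lambda>(J, J', j) l p. if l = 0 then 0 else (of_bool (l \<in> J) - of_bool (l \<in> J')) * (p l $ j))"
  define C where "C = pos ` {1..T} \<union> up ` \<I> \<union> (\<lambda>J l p. - up J l p) ` \<I> \<union> eq ` (\<I> \<times> \<I> \<times> UNIV)"
  have bool_sum: "(\<Sum>l\<le>T. of_bool (l \<in> J) * f l) = sum f J" if "J \<in> \<I>" for f :: "nat \<Rightarrow> real" and J
  proof -
    have "(\<Sum>l\<le>T. of_bool (l \<in> J) * f l) = (\<Sum>l\<in>J. of_bool (l \<in> J) * f l)"
      using sub[OF that] by (intro sum.mono_neutral_right) auto
    then show ?thesis by simp
  qed
  have pos: "(\<Sum>l\<le>T. pos i l p * x l) = x i" if "i \<in> {1..T}" for i p x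
  proof -
    have "(\<Sum>l\<le>T. pos i l p * x l) = (\<Sum>l\<le>T. if l = i then x l else 0)"
      unfolding pos_def by (intro sum.cong) auto
    then show ?thesis using that by simp
  qed
  have up: "(\<Sum>l\<le>T. up J l p * x l) = sum x J - x 0" if "J \<in> \<I>" for J p x
  proof -
    have "(\<Sum>l\<le>T. up J l p * x l) = (\<Sum>l\<le>T. of_bool (l \<in> J) * x l) - (\<Sum>l\<le>T. if l = 0 then x l else 0)"
      unfolding up_def sum_subtractf[symmetric] by (intro sum.cong) (auto simp: algebra_simps)
    then show ?thesis using bool_sum[OF that] by simp
  qed
  have eq: "(\<Sum>l\<le>T. eq (J, J', j) l p * x l) =
      (\<Sum>l\<in>J. x l *\<^sub>R p l) $ j - (\<Sum>l\<in>J'. x l *\<^sub>R p l) $ j" if "J \<in> \<I>" "J' \<in> \<I>" for J J' j p x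
  proof -
    have "0 \<notin> J" "0 \<notin> J'" using that sub by fastforce+
    then have "(\<Sum>l\<le>T. eq (J, J', j) l p * x l) =
       (\<Sum>l\<le>T. of_bool (l \<in> J) * (x l * p l $ j)) - (\<Sum>l\<le>T. of_bool (l \<in> J') * (x l * p l $ j))"
      unfolding eq_def sum_subtractf[symmetric] by (intro sum.cong) (auto simp: algebra_simps)
    then show ?thesis using bool_sum that by simp
  qed
  have Tv: "Tv \<I> p \<longleftrightarrow> (\<exists>\<alpha>. (\<forall>i\<in>{1..T}. 0 \<le> \<alpha> i) \<and> (\<forall>J\<in>\<I>. sum \<alpha> J = 1) \<and>
        (\<forall>J\<in>\<I>. \<forall>J'\<in>\<I>. (\<Sum>i\<in>J. \<alpha> i *\<^sub>R p i) = (\<Sum>i\<in>J'. \<alpha> i *\<^sub>R p i)))" for p :: "nat \<Rightarrow> real ^ 'n"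
    unfolding un[symmetric] using disj fin ne by (rule Tv_iff)
  have "Tv \<I> p \<longleftrightarrow> (\<exists>x. x 0 = 1 \<and> (\<forall>c\<in>C. (\<Sum>j\<le>T. c j p * x j) \<ge> 0))" for p :: "nat \<Rightarrow> real ^ 'n"
  proof
    assume "Tv \<I> p"
    then obtain \<alpha> where \<alpha>: "\<forall>i\<in>{1..T}. 0 \<le> \<alpha> i" "\<forall>J\<in>\<I>. sum \<alpha> J = 1"
     "\<forall>J\<in>\<I>. \<forall>J'\<in>\<I>. (\<Sum>i\<in>J. \<alpha> i *\<^sub>R p i) = (\<Sum>i\<in>J'. \<alpha> i *\<^sub>R p i)"
      unfolding Tv by (elim exE conjE) (rule that)
    define x where "x = \<alpha>(0 := 1)"
    have x: "sum x J = sum \<alpha> J" "(\<Sum>i\<in>J. x i *\<^sub>R p i) = (\<Sum>i\<in>J. \<alpha> i *\<^sub>R p i)" if "J \<in> \<I>" for J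
    proof -
      have "x i = \<alpha> i" if "i \<in> J" for i using sub[OF \<open>J \<in> \<I>\<close>] that by (auto simp: x_def)
      then show "sum x J = sum \<alpha> J" "(\<Sum>i\<in>J. x i *\<^sub>R p i) = (\<Sum>i\<in>J. \<alpha> i *\<^sub>R p i)" by simp_all
    qed
    have nonneg: "(\<Sum>j\<le>T. c j p * x j) \<ge> 0" if c: "c \<in> C" for c
    proof -
      have "c \<in> pos ` {1..T} \<or> c \<in> up ` \<I> \<or> c \<in> (\<lambda>J l p. - up J l p) ` \<I> \<or> c \<in> eq ` (\<I> \<times> \<I> \<times> UNIV)"
        using c unfolding C_def Un_iff disj_assoc .
      then show ?thesis
      proof (elim disjE imageE)
        fix i assume i: "c = pos i" "i \<in> {1..T}"
        then have "i \<noteq> 0" by auto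
        then show ?thesis unfolding i(1) pos[OF i(2)] using bspec[OF \<alpha>(1) i(2)] by (simp add: x_def)
      next
        fix J assume J: "c = up J" "J \<in> \<I>"
        show ?thesis unfolding J(1) up[OF J(2)] x(1)[OF J(2)] using bspec[OF \<alpha>(2) J(2)] by (simp add: x_def)
      next
        fix J assume J: "c = (\<lambda>l p. - up J l p)" "J \<in> \<I>"
        show ?thesis
          unfolding J(1) mult_minus_left sum_negf up[OF J(2)] x(1)[OF J(2)]
          using bspec[OF \<alpha>(2) J(2)] by (simp add: x_def)
      next
        fix z assume z: "c = eq z" "z \<in> \<I> \<times> \<I> \<times> UNIV"
        obtain J J' j where zJ: "z = (J, J', j)" by (cases z)
        then have J: "J \<in> \<I>" "J' \<in> \<I>" using z(2) by simp_all
        have "(\<Sum>i\<in>J. x i *\<^sub>R p i) = (\<Sum>i\<in>J'. x i *\<^sub>R p i)"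
          unfolding x(2)[OF J(1)] x(2)[OF J(2)] by (rule bspec[OF bspec[OF \<alpha>(3) J(1)] J(2)])
        then show ?thesis unfolding z(1) zJ eq[OF J] by simp
      qed
    qed
    have "x 0 = 1" by (simp add: x_def)
    then show "\<exists>x. x 0 = 1 \<and> (\<forall>c\<in>C. (\<Sum>j\<le>T. c j p * x j) \<ge> 0)"
      by (intro exI[of _ x] conjI ballI nonneg)
  next
    assume "\<exists>x. x 0 = 1 \<and> (\<forall>c\<in>C. (\<Sum>j\<le>T. c j p * x j) \<ge> 0)"
    then obtain x where x0: "x 0 = 1" and C: "\<forall>c\<in>C. (\<Sum>j\<le>T. c j p * x j) \<ge> 0" by (elim exE conjE) (rule that)
    note x = bspec[OF C]
    have 1: "0 \<le> x i" if "i \<in> {1..T}" for i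
    proof -
      have "pos i \<in> C" unfolding C_def using that by (intro UnI1 imageI)
      from x[OF this] show ?thesis unfolding pos[OF that] .
    qed
    have 2: "sum x J = 1" if "J \<in> \<I>" for J
    proof -
      have 1: "up J \<in> C"
        unfolding C_def using that by (intro UnI1[OF UnI1] UnI2 imageI)
      have 2: "(\<lambda>l p. - up J l p) \<in> C"
        unfolding C_def using that by (intro UnI1[OF UnI2] image_eqI[where x = J] refl)
      from x[OF 1] x[OF 2] show ?thesis using x0 unfolding mult_minus_left sum_negf up[OF that] by simp
    qed
    have 3: "(\<Sum>l\<in>J. x l *\<^sub>R p l) $ j \<ge> (\<Sum>l\<in>J'. x l *\<^sub>R p l) $ j" if "J \<in> \<I>" "J' \<in> \<I>" for J J' j
    proof -
      have "eq (J, J', j) \<in> C" unfolding C_def using that by (intro UnI2 imageI SigmaI UNIV_I)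
      from x[OF this] show ?thesis unfolding eq[OF that] by simp
    qed
    have 4: "(\<Sum>l\<in>J. x l *\<^sub>R p l) = (\<Sum>l\<in>J'. x l *\<^sub>R p l)" if "J \<in> \<I>" "J' \<in> \<I>" for J J'
      unfolding vec_eq_iff by (intro allI order.antisym 3 that)
    show "Tv \<I> p"
      unfolding Tv by (intro exI[of _ x] conjI ballI 1 2 4)
  qed
  moreover have "semialgebraic T (\<lambda>p::nat \<Rightarrow> real ^ 'n. \<exists>x. x 0 = 1 \<and> (\<forall>c\<in>C. (\<Sum>j\<le>T. c j p * x j) \<ge> 0))"
  proof (rule semialgebraic_linear_feasible)
    show "finite C" using finI by (simp add: C_def)
    have e: "tuple_polynomial T (eq (J, J', j) l)" if "l \<le> T" for J J' j l
    proof (cases "l = 0")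
      case True
      then have "eq (J, J', j) l = (\<lambda>p. 0)" by (simp add: eq_def fun_eq_iff)
      then show ?thesis by (simp add: tuple_polynomial.const)
    next
      case False
      then show ?thesis using that unfolding eq_def
        by (auto intro!: tuple_polynomial.mult tuple_polynomial.const tuple_polynomial.coord tuple_polynomial_uminus)
    qed
    fix c l assume c: "c \<in> C" and l: "l \<le> T"
    have "c \<in> pos ` {1..T} \<or> c \<in> up ` \<I> \<or> c \<in> (\<lambda>J l p. - up J l p) ` \<I> \<or> c \<in> eq ` (\<I> \<times> \<I> \<times> UNIV)"
      using c unfolding C_def Un_iff disj_assoc .
    then show "tuple_polynomial T (c l)"
    proof (elim disjE imageE)
      fix z assume "c = eq z"
      then show ?thesis using e[OF l] by (cases z) simp
    qed (simp_all add: pos_def up_def tuple_polynomial.const)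
  qed
  ultimately show ?thesis by presburger
qed

section \<open>Fast growing coordinates\<close>

lemma eventually_at_top_poly_nonzero:
  fixes q :: "real poly"
  assumes "q \<noteq> 0"
  shows "eventually (\<lambda>t. poly q t \<noteq> 0) at_top"
proof -
  have "bdd_above {t. poly q t = 0}" using bdd_above_finite[OF poly_roots_finite[OF assms]] .
  then obtain M where M: "\<forall>t\<in>{t. poly q t = 0}. t \<le> M" unfolding bdd_above_def ..
  have "poly q t \<noteq> 0" if "t > M" for t using M that by fastforce
  then show ?thesis using eventually_mono[OF eventually_gt_at_top[of M]] by simp
qed

text \<open>Shaped for \<open>2 \<times> 2\<close> minors: both factors of the off-diagonal product
  come before the largest entry, and the remaining entry is at least 1.\<close>

definition fast_growing :: "real \<Rightarrow> nat \<Rightarrow> (nat \<Rightarrow> real) \<Rightarrow> bool" where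
  "fast_growing C m X \<longleftrightarrow> (\<forall>i<m. 1 \<le> X i \<and> (\<forall>a<i. \<forall>b<i. C * X a * X b < X i))"

text \<open>
  The coordinates are chosen one after the other. Each \<open>f h\<close> keeps a witness \<open>Y\<close> with
  \<open>f h Y \<noteq> 0\<close> that agrees with \<open>X\<close> on the coordinates chosen so far; a new coordinate only has to
  avoid finitely many roots.
\<close>

lemma exists_fast_growing_nonzero:
  fixes f :: "'h \<Rightarrow> (nat \<Rightarrow> real) \<Rightarrow> real"
  assumes fin: "finite H"
    and pol: "\<And>h Y m. h \<in> H \<Longrightarrow> \<exists>q. \<forall>t. f h (Y(m := t)) = poly q t"
    and nz: "\<And>h. h \<in> H \<Longrightarrow> \<exists>Y. f h Y \<noteq> 0"
  shows "\<exists>X. fast_growing C m X \<and> (\<forall>h\<in>H. \<exists>Y. (\<forall>i<m. Y i = X i) \<and> f h Y \<noteq> 0)"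
proof (induction m)
  case 0
  then show ?case using nz by (simp add: fast_growing_def)
next
  case (Suc m)
  then obtain X where X: "fast_growing C m X"
    and "\<forall>h\<in>H. \<exists>Y. (\<forall>i<m. Y i = X i) \<and> f h Y \<noteq> 0" by blast
  then obtain Y where Y: "\<And>h. h \<in> H \<Longrightarrow> (\<forall>i<m. Y h i = X i) \<and> f h (Y h) \<noteq> 0"
    by metis
  have "eventually (\<lambda>t. f h ((Y h)(m := t)) \<noteq> 0) at_top" if h: "h \<in> H" for h
  proof -
    obtain q where q: "\<And>t. f h ((Y h)(m := t)) = poly q t" using pol[OF h] by metis
    have "poly q (Y h m) \<noteq> 0" using Y[OF h] q[of "Y h m"] by simp
    then have "q \<noteq> 0" by auto
    then show ?thesis using eventually_at_top_poly_nonzero q by simp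
  qed
  then have "eventually (\<lambda>t. \<forall>h\<in>H. f h ((Y h)(m := t)) \<noteq> 0) at_top"
    using fin by (simp add: eventually_ball_finite)
  moreover have "eventually (\<lambda>t. \<forall>a\<in>{..<m}. \<forall>b\<in>{..<m}. C * X a * X b < t) at_top"
    by (intro eventually_ball_finite finite_lessThan ballI eventually_gt_at_top)
  ultimately have "eventually (\<lambda>t. (\<forall>h\<in>H. f h ((Y h)(m := t)) \<noteq> 0) \<and>
      (\<forall>a\<in>{..<m}. \<forall>b\<in>{..<m}. C * X a * X b < t) \<and> 1 \<le> t) at_top"
    by (intro eventually_conj eventually_ge_at_top)
  from eventually_happens'[OF trivial_limit_at_top_linorder this]
  obtain t where t: "\<forall>h\<in>H. f h ((Y h)(m := t)) \<noteq> 0"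
    "\<forall>a\<in>{..<m}. \<forall>b\<in>{..<m}. C * X a * X b < t" "1 \<le> t"
    by (elim exE conjE) (rule that)
  have "fast_growing C (Suc m) (X(m := t))"
    using X t(2,3) by (simp add: fast_growing_def less_Suc_eq)
  moreover have "\<exists>Z. (\<forall>i<Suc m. Z i = (X(m := t)) i) \<and> f h Z \<noteq> 0" if h: "h \<in> H" for h
    using t(1) Y[OF h] h by (intro exI[of _ "(Y h)(m := t)"]) (simp add: less_Suc_eq)
  ultimately show ?case by blast
qed

text \<open>All coordinates are laid out in one sequence \<open>X\<close>, point by point, so that
  growth of \<open>X\<close> compares coordinates within a point as well as between points.
  Positions below \<open>Suc n * d\<close> cover every point with index at most
  \<open>n\<close>.\<close>

lemma exists_fast_growing_generic:
  fixes b :: "((nat \<Rightarrow> real ^ 'n::finite) \<Rightarrow> real) bool_comb" and \<kappa> :: "'n \<Rightarrow> nat"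
  assumes \<kappa>: "bij_betw \<kappa> UNIV {..<d}"
    and atoms: "\<And>f. f \<in> atoms b \<Longrightarrow> tuple_polynomial k f \<and> f \<noteq> (\<lambda>p. 0)"
  shows "\<exists>X. fast_growing C (Suc n * d) X \<and> generic k b n (\<lambda>i. \<chi> j. X (i * d + \<kappa> j))"
proof -
  define P :: "(nat \<Rightarrow> real) \<Rightarrow> nat \<Rightarrow> real ^ 'n" where "P X i = (\<chi> j. X (i * d + \<kappa> j))" for X i
  have \<kappa>_less: "\<kappa> j < d" for j using bij_betwE[OF \<kappa>] by simp
  \<comment> \<open>Extensional functions make the set of selections finite; a selection matters
    only on \<open>{1..k}\<close>.\<close>
  define S where "S = {s \<in> {1..k} \<rightarrow>\<^sub>E {1..n}. inj_on s {1..k}}"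
  define h where "h = (\<lambda>(f :: (nat \<Rightarrow> real ^ 'n) \<Rightarrow> real, s :: nat \<Rightarrow> nat) X. f (P X \<circ> s))"
  have "\<exists>X. fast_growing C (Suc n * d) X \<and>
    (\<forall>z\<in>atoms b \<times> S. \<exists>Y. (\<forall>i<Suc n * d. Y i = X i) \<and> h z Y \<noteq> 0)"
  proof (rule exists_fast_growing_nonzero)
    have "finite S" unfolding S_def by (simp add: finite_PiE)
    then show "finite (atoms b \<times> S)" by (simp add: finite_atoms)
  next
    fix z Y m assume "z \<in> atoms b \<times> S"
    moreover obtain f s where z: "z = (f, s)" by (cases z)
    ultimately have f: "f \<in> atoms b" by simp
    have "\<exists>q. \<forall>t. (P (Y(m := t)) \<circ> s) i $ j = poly q t" for i j
    proof (cases "s i * d + \<kappa> j = m")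
      case True
      then show ?thesis by (intro exI[of _ "[:0, 1:]"]) (simp add: P_def)
    next
      case False
      then show ?thesis by (intro exI[of _ "[:Y (s i * d + \<kappa> j):]"]) (simp add: P_def)
    qed
    then show "\<exists>q. \<forall>t. h z (Y(m := t)) = poly q t"
      unfolding z h_def case_prod_conv
      by (rule tuple_polynomial_along_curve[OF conjunct1[OF atoms[OF f]]])
  next
    fix z assume "z \<in> atoms b \<times> S"
    moreover obtain f s where z: "z = (f, s)" by (cases z)
    ultimately have f: "f \<in> atoms b" and s: "s \<in> S" by simp_all
    obtain p where p: "f p \<noteq> 0"
      using conjunct2[OF atoms[OF f]] unfolding fun_eq_iff not_all ..
    \<comment> \<open>Position \<open>m\<close> is coordinate \<open>m mod d\<close> of point
      \<open>m div d\<close>. Since \<open>s\<close> is injective, the selected points can be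
      prescribed independently, here as those of \<open>p\<close>.\<close>
    define Y where "Y m = p (inv_into {1..k} s (m div d)) $ inv \<kappa> (m mod d)" for m
    have inj: "inj \<kappa>" using \<kappa> by (simp add: bij_betw_def)
    have "(P Y \<circ> s) i = p i" if "i \<in> {1..k}" for i
    proof -
      have "(P Y \<circ> s) i $ j = p i $ j" for j
      proof -
        have "(s i * d + \<kappa> j) div d = s i" "(s i * d + \<kappa> j) mod d = \<kappa> j"
          using \<kappa>_less[of j] by auto
        then show ?thesis using s that inj by (simp add: P_def Y_def S_def)
      qed
      then show ?thesis by (simp add: vec_eq_iff)
    qed
    then have "f (P Y \<circ> s) = f p"
      by (rule tuple_polynomial_cong[OF conjunct1[OF atoms[OF f]]])
    then show "\<exists>Y. h z Y \<noteq> 0" using p by (intro exI[of _ Y]) (simp add: z h_def)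
  qed
  then obtain X where X: "fast_growing C (Suc n * d) X"
    and h: "\<forall>z\<in>atoms b \<times> S. \<exists>Y. (\<forall>i<Suc n * d. Y i = X i) \<and> h z Y \<noteq> 0" by (elim exE conjE) (rule that)
  have "generic k b n (P X)"
    unfolding generic_def
  proof (intro allI impI ballI)
    fix s f assume s: "inj_on s {1..k} \<and> s ` {1..k} \<subseteq> {1..n}" and f: "f \<in> atoms b"
    define s' where "s' = restrict s {1..k}"
    have "s' \<in> S"
      using s unfolding S_def s'_def by (simp add: restrict_PiE_iff image_subset_iff inj_on_restrict_eq)
    then have "(f, s') \<in> atoms b \<times> S" using f by simp
    from bspec[OF h this] obtain Y where Y: "\<forall>i<Suc n * d. Y i = X i" "h (f, s') Y \<noteq> 0"
      by (elim exE conjE) (rule that)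
    have "(P Y \<circ> s') i = (P X \<circ> s) i" if i: "i \<in> {1..k}" for i
    proof -
      have "s i \<le> n" using conjunct2[OF s] i unfolding image_subset_iff by simp
      then have "s i * d \<le> n * d" by (rule mult_le_mono1)
      then have "s i * d + \<kappa> j < Suc n * d" for j
        using \<kappa>_less[of j] unfolding mult_Suc by linarith
      then show ?thesis using i Y(1) by (simp add: P_def s'_def vec_eq_iff)
    qed
    then have "f (P Y \<circ> s') = f (P X \<circ> s)"
      by (rule tuple_polynomial_cong[OF conjunct1[OF atoms[OF f]]])
    then show "f (P X \<circ> s) \<noteq> 0" using Y by (simp add: h_def)
  qed
  then show ?thesis using X unfolding P_def[abs_def] by (intro exI[of _ X] conjI)
qed

section \<open>Tverberg partitions of stretched points\<close>

lemma sum_bounds_argmax: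
  fixes f :: "'i \<Rightarrow> real"
  assumes "finite J" "card J \<le> n" "i \<in> J" "\<And>j. j \<in> J \<Longrightarrow> f j \<le> f i" "\<And>j. j \<in> J \<Longrightarrow> 0 \<le> f j"
  shows "sum f J \<le> n * f i"
proof -
  have "sum f J \<le> card J * f i" using assms by (intro sum_bounded_above) auto
  also have "\<dots> \<le> n * f i" using assms by (intro mult_right_mono) auto
  finally show ?thesis .
qed

text \<open>Gaussian elimination: an equation with a nonzero coefficient removes one unknown along
  with itself, and one without holds for every \<open>x\<close>.\<close>

lemma homogeneous_system_nontrivial_solution:
  fixes e :: "'e \<Rightarrow> 'v \<Rightarrow> real"
  assumes "finite E" "finite V" "card E < card V"
  shows "\<exists>x. (\<exists>v\<in>V. x v \<noteq> 0) \<and> (\<forall>c\<in>E. (\<Sum>v\<in>V. e c v * x v) = 0)"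
  using assms
proof (induction E arbitrary: e V rule: finite_induct)
  case empty
  then have "V \<noteq> {}" by auto
  then show ?case by (intro exI[of _ "\<lambda>_. 1"]) auto
next
  case (insert c0 E)
  show ?case
  proof (cases "\<exists>w\<in>V. e c0 w \<noteq> 0")
    case False
    obtain x where x: "\<exists>v\<in>V. x v \<noteq> 0" "\<forall>c\<in>E. (\<Sum>v\<in>V. e c v * x v) = 0"
      using insert.IH[of V e] insert.prems insert.hyps by auto
    have "(\<Sum>v\<in>V. e c0 v * x v) = 0" using False by (intro sum.neutral) auto
    then show ?thesis using x by (intro exI[of _ x]) auto
  next
    case True
    then obtain w where w: "w \<in> V" "e c0 w \<noteq> 0" by blast
    \<comment> \<open>Subtracting a multiple of equation \<open>c0\<close> kills the coefficient of
      the pivot \<open>w\<close>; \<open>y\<close> below restores the value at \<open>w\<close> by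
      solving \<open>c0\<close>.\<close>
    define e' where "e' c v = e c v - e c w / e c0 w * e c0 v" for c v
    have "card (V - {w}) = card V - 1" using w insert.prems by simp
    then have "card E < card (V - {w})" using insert.prems insert.hyps by simp
    then obtain x where x: "\<exists>v\<in>V - {w}. x v \<noteq> 0" "\<And>c. c \<in> E \<Longrightarrow> (\<Sum>v\<in>V - {w}. e' c v * x v) = 0"
      using insert.IH[of "V - {w}" e'] insert.prems by blast
    define s where "s = (\<Sum>v\<in>V - {w}. e c0 v * x v)"
    define y where "y = x(w := - s / e c0 w)"
    have split: "(\<Sum>v\<in>V. e c v * y v) = e c w * (- s / e c0 w) + (\<Sum>v\<in>V - {w}. e c v * x v)" for c
    proof -
      have "(\<Sum>v\<in>V. e c v * y v) = e c w * y w + (\<Sum>v\<in>V - {w}. e c v * y v)"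
        using insert.prems w by (intro sum.remove) auto
      also have "(\<Sum>v\<in>V - {w}. e c v * y v) = (\<Sum>v\<in>V - {w}. e c v * x v)"
        by (intro sum.cong) (auto simp: y_def)
      finally show ?thesis by (simp add: y_def)
    qed
    have "(\<Sum>v\<in>V. e c v * y v) = 0" if c: "c \<in> insert c0 E" for c
    proof (cases "c = c0")
      case True
      then show ?thesis using split[of c0] w by (simp add: s_def)
    next
      case False
      then have "0 = (\<Sum>v\<in>V - {w}. e c v * x v - e c w / e c0 w * (e c0 v * x v))"
        using x(2)[of c] c unfolding e'_def by (simp add: algebra_simps)
      also have "\<dots> = (\<Sum>v\<in>V - {w}. e c v * x v) - e c w / e c0 w * s"
        unfolding s_def sum_subtractf sum_distrib_left ..
      finally show ?thesis unfolding split by simp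
    qed
    moreover have "\<exists>v\<in>V. y v \<noteq> 0" using x(1) by (auto simp: y_def)
    ultimately show ?thesis by blast
  qed
qed

text \<open>
  Row \<open>i\<close> of \<open>x\<close> holds the homogeneous coordinates of the \<open>i\<close>-th point. The growth condition says
  that consecutive \<open>2 \<times> 2\<close> minors of \<open>x\<close> are not just positive but dominated by their diagonal.
\<close>

locale stretched =
  fixes d r T :: nat and \<I> :: "nat set set" and x :: "nat \<Rightarrow> nat \<Rightarrow> real"
  assumes r: "r \<ge> 1" and T_def: "T = (r - 1) * (d + 1) + 1"
    and part: "partition_on {1..T} \<I>" and card_I: "card \<I> = r"
    and pos: "i \<in> {1..T} \<Longrightarrow> k \<le> d \<Longrightarrow> x i k > 0"
    and growth: "i \<in> {1..T} \<Longrightarrow> j \<in> {1..T} \<Longrightarrow> j < i \<Longrightarrow> k < d \<Longrightarrow>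
      6 * real T ^ 2 * (real d + 1) * (x i k * x j (Suc k)) < x i (Suc k) * x j k"
begin

text \<open>First index of block \<open>{c k..c (Suc k)}\<close>, with blocks numbered from 0 like
  the homogeneous coordinates. A block has \<open>r\<close> indices and shares its last one with the
  next block.\<close>

definition c :: "nat \<Rightarrow> nat" where "c k = (r - 1) * k + 1"

text \<open>The Tverberg condition up to scaling: coordinate 0 carries the total weight of a part,
  and \<open>y 0 > 0\<close> will replace the normalization to weight 1.\<close>

definition balanced :: "(nat \<Rightarrow> real) \<Rightarrow> (nat \<Rightarrow> real) \<Rightarrow> bool" where
  "balanced \<alpha> y \<longleftrightarrow> (\<forall>J\<in>\<I>. \<forall>k\<le>d. (\<Sum>i\<in>J. \<alpha> i * x i k) = y k)"

lemma c_0: "c 0 = 1" and c_Suc: "c (Suc k) = c k + (r - 1)" and c_last: "c (Suc d) = T"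
  and T_pos: "T \<ge> 1"
  by (simp_all add: c_def T_def)

lemma c_mono: "k \<le> l \<Longrightarrow> c k \<le> c l"
  by (simp add: c_def)

lemma c_range: "k \<le> Suc d \<Longrightarrow> c k \<in> {1..T}"
  using c_mono[of k "Suc d"] c_mono[of 0 k] by (simp add: c_last c_0)

lemma I_sub: "J \<in> \<I> \<Longrightarrow> J \<subseteq> {1..T}" and I_ne: "J \<in> \<I> \<Longrightarrow> J \<noteq> {}"
  and I_Un: "\<Union>\<I> = {1..T}" and I_disj: "J \<in> \<I> \<Longrightarrow> J' \<in> \<I> \<Longrightarrow> i \<in> J \<Longrightarrow> i \<in> J' \<Longrightarrow> J = J'"
  using part by (auto simp: partition_on_def disjoint_def)

lemma I_mem: "J \<in> \<I> \<Longrightarrow> i \<in> J \<Longrightarrow> i \<in> {1..T}"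
  using I_sub by blast

lemma I_fin: "J \<in> \<I> \<Longrightarrow> finite J"
  using I_sub finite_subset by blast

lemma I_card: "J \<in> \<I> \<Longrightarrow> card J \<le> T"
  using card_mono[of "{1..T}" J] I_sub by simp

lemma colorful_iff: "colorful d r \<I> \<longleftrightarrow> (\<forall>k\<le>d. \<forall>J\<in>\<I>. \<exists>!m. m \<in> {c k..c (Suc k)} \<and> m \<in> J)"
proof -
  have "colorful d r \<I> \<longleftrightarrow> (\<forall>k\<in>Suc ` {..d}. \<forall>J\<in>\<I>. \<exists>!m. m \<in> {(r - 1) * (k - 1) + 1..(r - 1) * k + 1} \<and> m \<in> J)"
    unfolding colorful_def image_Suc_atMost by simp
  also have "\<dots> \<longleftrightarrow> (\<forall>k\<in>{..d}. \<forall>J\<in>\<I>. \<exists>!m. m \<in> {c k..c (Suc k)} \<and> m \<in> J)"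
    by (simp add: c_def)
  finally show ?thesis by (simp only: Ball_def atMost_iff)
qed

text \<open>Consecutive sets share at most one index, so \<open>d + 1\<close> sorted sets of size
  \<open>r\<close> already need all \<open>T\<close> indices. Counting from below gives
  \<open>c k \<le> i\<close>, counting from above \<open>i \<le> c (Suc k)\<close>, and such an
  interval has only \<open>r\<close> elements.\<close>

lemma sorted_transversals_eq_blocks:
  assumes sub: "\<And>k. k \<le> d \<Longrightarrow> E k \<subseteq> {1..T}" and card: "\<And>k. k \<le> d \<Longrightarrow> card (E k) = r"
    and sorted: "\<And>k i j. k < d \<Longrightarrow> i \<in> E k \<Longrightarrow> j \<in> E (Suc k) \<Longrightarrow> i \<le> j"
    and k: "k \<le> d"
  shows "E k = {c k..c (Suc k)}"
proof -
  have fin: "finite (E k)" if "k \<le> d" for k using sub[OF that] finite_subset by blast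
  have ne: "E k \<noteq> {}" if "k \<le> d" for k using card[OF that] r by auto
  have lower: "\<forall>i\<in>E k. c k \<le> i" if "k \<le> d" for k
    using that
  proof (induction k)
    case 0
    then show ?case using sub[of 0] by (auto simp: c_0)
  next
    case (Suc k)
    then have "E k \<subseteq> {c k..Max (E k)}" using fin[of k] by auto
    then have "r \<le> Suc (Max (E k)) - c k" using card[of k] Suc.prems card_mono[of "{c k..Max (E k)}" "E k"] by simp
    then have "c (Suc k) \<le> Max (E k)" using r by (simp add: c_Suc)
    moreover have "Max (E k) \<in> E k" using fin ne Suc.prems by simp
    ultimately show ?case using sorted[of k "Max (E k)"] Suc.prems by fastforce
  qed
  have upper: "\<forall>i\<in>E k. i \<le> c (Suc k)" if "k \<le> d"
    using that
  proof (induction rule: inc_induct)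
    case base
    then show ?case using sub[of d] by (auto simp: c_last)
  next
    case (step k)
    then have "E (Suc k) \<subseteq> {Min (E (Suc k))..c (Suc (Suc k))}" using fin[of "Suc k"] by auto
    then have "r \<le> Suc (c (Suc (Suc k))) - Min (E (Suc k))"
      using card[of "Suc k"] step.hyps card_mono[of "{Min (E (Suc k))..c (Suc (Suc k))}" "E (Suc k)"] by simp
    then have "Min (E (Suc k)) \<le> c (Suc k)" using r by (simp add: c_Suc)
    moreover have "Min (E (Suc k)) \<in> E (Suc k)" using fin ne step.hyps by simp
    ultimately show ?case using sorted[of k _ "Min (E (Suc k))"] step.hyps by fastforce
  qed
  have "E k \<subseteq> {c k..c (Suc k)}" using lower[OF k] upper[OF k] by auto
  moreover have "card {c k..c (Suc k)} = r" using r by (simp add: c_Suc)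
  ultimately show ?thesis using card[OF k] by (intro card_subset_eq) auto
qed

text \<open>
  Let \<open>m J k\<close> be the index of the dominating term of the \<open>k\<close>-th coordinate over the part \<open>J\<close>. By the
  growth condition, \<open>m J k \<le> m J' (k + 1)\<close> for all \<open>J\<close> and \<open>J'\<close>; as there are only \<open>T\<close> indices, this
  leaves no room: the indices \<open>m J k\<close> for fixed \<open>k\<close> form the block \<open>{c k..c (k + 1)}\<close>.
\<close>

lemma balanced_imp_colorful:
  assumes nonneg: "\<And>i. i \<in> {1..T} \<Longrightarrow> 0 \<le> \<alpha> i" and bal: "balanced \<alpha> y" and y0: "y 0 > 0"
  shows "colorful d r \<I>"
proof -
  have term_nonneg: "0 \<le> \<alpha> i * x i k" if "i \<in> {1..T}" "k \<le> d" for i k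
    using nonneg[OF that(1)] pos[OF that] by simp
  have term_le: "\<alpha> i * x i k \<le> y k" if "J \<in> \<I>" "i \<in> J" "k \<le> d" for J i k
  proof -
    have "\<alpha> i * x i k \<le> (\<Sum>i\<in>J. \<alpha> i * x i k)"
      using that I_fin I_mem[OF that(1)] term_nonneg by (intro member_le_sum) auto
    then show ?thesis using bal that by (simp add: balanced_def)
  qed
  \<comment> \<open>Total weight \<open>y 0 > 0\<close> forces some positive weight, and since all
    entries of \<open>x\<close> are positive, that weight contributes to every coordinate.\<close>
  have y_pos: "y k > 0" if k: "k \<le> d" for k
  proof -
    have "\<I> \<noteq> {}" using card_I r by auto
    then obtain J where J: "J \<in> \<I>" by blast
    have "(\<Sum>i\<in>J. \<alpha> i * x i 0) \<noteq> 0" using bal J y0 by (simp add: balanced_def)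
    then obtain i where i: "i \<in> J" "\<alpha> i * x i 0 \<noteq> 0" by (meson sum.neutral)
    then have "i \<in> {1..T}" "\<alpha> i \<noteq> 0" using I_mem[OF J i(1)] by simp_all
    then have "0 < \<alpha> i * x i k" using nonneg[of i] pos[of i k] k by simp
    then show ?thesis using term_le[OF J i(1) k] by linarith
  qed
  have "\<exists>i\<in>J. \<forall>j\<in>J. \<alpha> j * x j k \<le> \<alpha> i * x i k" if "J \<in> \<I>" for J k
  proof -
    have "Max ((\<lambda>i. \<alpha> i * x i k) ` J) \<in> (\<lambda>i. \<alpha> i * x i k) ` J"
      using I_fin[OF that] I_ne[OF that] by (intro Max_in) auto
    then obtain i where i: "i \<in> J" "Max ((\<lambda>i. \<alpha> i * x i k) ` J) = \<alpha> i * x i k" by auto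
    have "\<alpha> j * x j k \<le> \<alpha> i * x i k" if "j \<in> J" for j
      using that I_fin[OF \<open>J \<in> \<I>\<close>] unfolding i(2)[symmetric] by simp
    then show ?thesis using i(1) by blast
  qed
  then obtain m where m: "\<And>J k. J \<in> \<I> \<Longrightarrow> m J k \<in> J"
    and m_max: "\<And>J k j. J \<in> \<I> \<Longrightarrow> j \<in> J \<Longrightarrow> \<alpha> j * x j k \<le> \<alpha> (m J k) * x (m J k) k"
    by metis
  have m_range: "m J k \<in> {1..T}" if "J \<in> \<I>" for J k using m[OF that] I_sub[OF that] by blast
  have dom: "y k \<le> T * (\<alpha> (m J k) * x (m J k) k)" if "J \<in> \<I>" "k \<le> d" for J k
  proof -
    have "(\<Sum>i\<in>J. \<alpha> i * x i k) \<le> T * (\<alpha> (m J k) * x (m J k) k)"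
      using that I_fin I_card m m_max I_mem[OF that(1)] term_nonneg
      by (intro sum_bounds_argmax[where f = "\<lambda>i. \<alpha> i * x i k"]) auto
    then show ?thesis using bal that by (simp add: balanced_def)
  qed
  define E where "E k = (\<lambda>J. m J k) ` \<I>" for k
  have "E k = {c k..c (Suc k)}" if "k \<le> d" for k
    using _ _ _ that
  proof (rule sorted_transversals_eq_blocks)
    show "E k \<subseteq> {1..T}" for k unfolding E_def using m_range by auto
    show "card (E k) = r" for k
    proof -
      have "inj_on (\<lambda>J. m J k) \<I>"
      proof (rule inj_onI)
        fix J J' assume "J \<in> \<I>" "J' \<in> \<I>" "m J k = m J' k"
        then show "J = J'" using I_disj[of J J' "m J k"] m[of J k] m[of J' k] by simp
      qed
      then show ?thesis unfolding E_def by (simp add: card_image card_I)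
    qed
    fix k i j assume k: "k < d" and "i \<in> E k" "j \<in> E (Suc k)"
    then obtain J J' where J: "J \<in> \<I>" "i = m J k" "J' \<in> \<I>" "j = m J' (Suc k)" unfolding E_def by blast
    have ij: "i \<in> {1..T}" "j \<in> {1..T}" using m_range J by auto
    show "i \<le> j"
    proof (rule ccontr)
      assume "\<not> i \<le> j"
      then have g: "6 * real T ^ 2 * (real d + 1) * (x i k * x j (Suc k)) < x i (Suc k) * x j k"
        using growth[OF ij] k by simp
      have "0 < T * (\<alpha> i * x i k)" "0 < T * (\<alpha> j * x j (Suc k))"
        using dom[of J k] dom[of J' "Suc k"] y_pos[of k] y_pos[of "Suc k"] J k by auto
      then have \<alpha>: "\<alpha> i > 0" "\<alpha> j > 0"
        using nonneg[OF ij(1)] nonneg[OF ij(2)] by (auto simp: zero_less_mult_iff)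
      have xp: "x i k > 0" "x j k > 0" "x i (Suc k) > 0" "x j (Suc k) > 0" using pos ij k by auto
      \<comment> \<open>The sums \<open>y k\<close> and \<open>y (Suc k)\<close> are common to all
        parts, so a term of one part is at most \<open>T\<close> times the dominating term of the
        other. In the product of the two bounds the weights cancel, which contradicts
        \<open>growth\<close>.\<close>
      have *: "\<alpha> j * x j k \<le> T * (\<alpha> i * x i k)"
        using term_le[of J' j k] dom[of J k] J k m by auto
      have **: "\<alpha> i * x i (Suc k) \<le> T * (\<alpha> j * x j (Suc k))"
        using term_le[of J i "Suc k"] dom[of J' "Suc k"] J k m by auto
      have "(\<alpha> j * x j k) * (\<alpha> i * x i (Suc k)) \<le> (T * (\<alpha> i * x i k)) * (T * (\<alpha> j * x j (Suc k)))"
        by (rule mult_mono[OF * **]) (use \<alpha> xp in simp_all)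
      then have "(\<alpha> i * \<alpha> j) * (x i (Suc k) * x j k) \<le> (\<alpha> i * \<alpha> j) * (real T ^ 2 * (x i k * x j (Suc k)))"
        by (simp add: power2_eq_square algebra_simps)
      then have "x i (Suc k) * x j k \<le> real T ^ 2 * (x i k * x j (Suc k))"
        using \<alpha> by simp
      moreover have "real T ^ 2 * (x i k * x j (Suc k)) * 1 \<le> real T ^ 2 * (x i k * x j (Suc k)) * (6 * (real d + 1))"
        using xp by (intro mult_left_mono) auto
      moreover have "6 * real T ^ 2 * (real d + 1) * (x i k * x j (Suc k)) =
          real T ^ 2 * (x i k * x j (Suc k)) * (6 * (real d + 1))" by (simp only: mult_ac)
      ultimately show False using g by simp
    qed
  qed
  note blocks = this
  show ?thesis unfolding colorful_iff
  proof (intro allI impI ballI)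
    fix k J assume k: "k \<le> d" and J: "J \<in> \<I>"
    show "\<exists>!i. i \<in> {c k..c (Suc k)} \<and> i \<in> J"
    proof (rule ex1I[of _ "m J k"])
      show "m J k \<in> {c k..c (Suc k)} \<and> m J k \<in> J"
        using m[OF J] J unfolding blocks[OF k, symmetric] E_def by blast
      fix i assume i: "i \<in> {c k..c (Suc k)} \<and> i \<in> J"
      then obtain J' where "J' \<in> \<I>" "i = m J' k" unfolding blocks[OF k, symmetric] E_def by blast
      then show "i = m J k" using I_disj[of J J' i] m[of J' k] J i by auto
    qed
  qed
qed

section \<open>The approximate solution given by the dominating terms\<close>

text \<open>Intended size of the dominating terms in coordinate \<open>k\<close>. The quotient is
  forced by the index \<open>c (Suc k)\<close>, which lies in two blocks and has to dominate both
  coordinates with the same weight.\<close>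

primrec scale :: "nat \<Rightarrow> real" where
  "scale 0 = x 1 0"
| "scale (Suc k) = scale k * (x (c (Suc k)) (Suc k) / x (c (Suc k)) k)"

lemma scale_pos: "k \<le> d \<Longrightarrow> scale k > 0"
proof (induction k)
  case 0
  then show ?case using pos[of 1 0] T_pos by simp
next
  case (Suc k)
  then show ?case using pos[of "c (Suc k)"] c_range[of "Suc k"] by simp
qed

lemma ex_block:
  assumes "1 < i" "i \<le> c (Suc n)"
  shows "\<exists>k\<le>n. c k < i \<and> i \<le> c (Suc k)"
  using assms(2)
proof (induction n)
  case 0
  then show ?case using assms(1) by (intro exI[of _ 0]) (simp add: c_0)
next
  case (Suc n)
  show ?case
  proof (cases "i \<le> c (Suc n)")
    case True
    then obtain k where "k \<le> n" "c k < i" "i \<le> c (Suc k)" using Suc.IH by blast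
    then show ?thesis by (intro exI[of _ k]) simp
  next
    case False
    then show ?thesis using Suc.prems by (intro exI[of _ "Suc n"]) simp
  qed
qed

text \<open>Half-open blocks: a shared index \<open>c (Suc k)\<close> with \<open>r > 1\<close> is
  assigned to the lower block \<open>k\<close>. Index 1 lies in no half-open block and is put into
  block 0.\<close>

definition \<kappa> :: "nat \<Rightarrow> nat" where
  "\<kappa> i = (if i \<le> 1 then 0 else SOME k. k \<le> d \<and> c k < i \<and> i \<le> c (Suc k))"

lemma \<kappa>_bounds:
  assumes "1 < i" "i \<le> T"
  shows "\<kappa> i \<le> d" "c (\<kappa> i) < i" "i \<le> c (Suc (\<kappa> i))"
proof -
  have "\<exists>k. k \<le> d \<and> c k < i \<and> i \<le> c (Suc k)"
    using ex_block[of i d] assms by (simp add: c_last)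
  from someI_ex[OF this] assms(1)
  show "\<kappa> i \<le> d" "c (\<kappa> i) < i" "i \<le> c (Suc (\<kappa> i))" unfolding \<kappa>_def by simp_all
qed

lemma \<kappa>_block:
  assumes "i \<in> {1..T}"
  shows "\<kappa> i \<le> d" "c (\<kappa> i) \<le> i" "i \<le> c (Suc (\<kappa> i))"
proof -
  have "\<kappa> i \<le> d \<and> c (\<kappa> i) \<le> i \<and> i \<le> c (Suc (\<kappa> i))"
  proof (cases "i = 1")
    case True
    then show ?thesis by (simp add: \<kappa>_def c_def)
  next
    case False
    then show ?thesis using \<kappa>_bounds[of i] assms by simp
  qed
  then show "\<kappa> i \<le> d" "c (\<kappa> i) \<le> i" "i \<le> c (Suc (\<kappa> i))" by simp_all
qed

lemma \<kappa>_unique: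
  assumes "c k < i" "i \<le> c (Suc k)" "i \<le> T"
  shows "\<kappa> i = k"
proof -
  have i: "1 < i" using assms(1) by (simp add: c_def)
  show ?thesis
  proof (rule ccontr)
    assume "\<kappa> i \<noteq> k"
    then consider "Suc (\<kappa> i) \<le> k" | "Suc k \<le> \<kappa> i" by linarith
    then show False
      using c_mono \<kappa>_bounds[OF i assms(3)] assms by cases (meson leD le_trans)+
  qed
qed

text \<open>The approximate solution: with weight \<open>a i\<close>, index \<open>i\<close>
  contributes exactly \<open>scale (\<kappa> i)\<close> to coordinate
  \<open>\<kappa> i\<close>.\<close>

definition a :: "nat \<Rightarrow> real" where "a i = scale (\<kappa> i) / x i (\<kappa> i)"

definition z :: "nat \<Rightarrow> nat \<Rightarrow> real" where "z k i = a i * x i k / scale k"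

text \<open>The quotient \<open>z k i / z (Suc k) i\<close>. It compares index \<open>i\<close> with
  the shared index \<open>c (Suc k)\<close>, which is what \<open>growth\<close> estimates.\<close>

definition \<rho> :: "nat \<Rightarrow> nat \<Rightarrow> real" where
  "\<rho> k i = (x i k * x (c (Suc k)) (Suc k)) / (x i (Suc k) * x (c (Suc k)) k)"

text \<open>\<open>real T ^ 2\<close> pays for bounding two sums by \<open>T\<close> times their
  largest terms. In \<open>colorful_imp_balanced\<close> at most \<open>d + 1\<close> errors of size
  \<open>2 * T * m / K\<close> add up, and the factor \<open>6 * (real d + 1)\<close> keeps their
  sum below \<open>m / 3\<close>.\<close>

abbreviation K :: real where "K \<equiv> 6 * real T ^ 2 * (real d + 1)"

lemma K_pos: "K > 0"
  using T_pos by simp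

lemma a_pos: "i \<in> {1..T} \<Longrightarrow> a i > 0"
  using pos[of i] \<kappa>_block[of i] scale_pos unfolding a_def by simp

lemma z_pos: "i \<in> {1..T} \<Longrightarrow> k \<le> d \<Longrightarrow> z k i > 0"
  using pos[of i k] a_pos[of i] scale_pos[of k] unfolding z_def by simp

lemma z_\<kappa>:
  assumes "i \<in> {1..T}"
  shows "z (\<kappa> i) i = 1"
  using pos[OF assms \<kappa>_block(1)[OF assms]] scale_pos[OF \<kappa>_block(1)[OF assms]] unfolding z_def a_def by simp

lemma z_step:
  assumes i: "i \<in> {1..T}" and k: "k < d"
  shows "z k i = z (Suc k) i * \<rho> k i"
proof -
  have "c (Suc k) \<in> {1..T}" using c_range[of "Suc k"] k by simp
  then have "x (c (Suc k)) k > 0" "x (c (Suc k)) (Suc k) > 0" "x i k > 0" "x i (Suc k) > 0"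
    using pos i k by simp_all
  then show ?thesis using scale_pos[of k] k unfolding z_def \<rho>_def by (simp add: field_simps)
qed

lemma \<rho>_bounds:
  assumes i: "i \<in> {1..T}" and k: "k < d"
  shows "i = c (Suc k) \<Longrightarrow> \<rho> k i = 1" "c (Suc k) < i \<Longrightarrow> K * \<rho> k i \<le> 1" "i < c (Suc k) \<Longrightarrow> K \<le> \<rho> k i"
proof -
  have c: "c (Suc k) \<in> {1..T}" using c_range[of "Suc k"] k by simp
  then have p: "x (c (Suc k)) k > 0" "x (c (Suc k)) (Suc k) > 0" "x i k > 0" "x i (Suc k) > 0"
    using pos i k by simp_all
  show "\<rho> k i = 1" if "i = c (Suc k)" using that p unfolding \<rho>_def by simp
  show "K * \<rho> k i \<le> 1" if "c (Suc k) < i"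
    using growth[OF i c that k] p unfolding \<rho>_def by (simp add: divide_le_eq mult.assoc)
  show "K \<le> \<rho> k i" if "i < c (Suc k)"
    using growth[OF c i that k] p unfolding \<rho>_def by (simp add: le_divide_eq mult_ac)
qed

text \<open>Start from \<open>z (\<kappa> i) i = 1\<close> and multiply or divide by
  \<open>\<rho>\<close>. Each step away from the blocks of \<open>i\<close> costs a factor
  \<open>K\<close>; the step between two blocks sharing \<open>i\<close> has
  \<open>\<rho> k i = 1\<close>.\<close>

lemma z_bounds:
  assumes i: "i \<in> {1..T}" and k: "k \<le> d"
  shows "i \<in> {c k..c (Suc k)} \<Longrightarrow> z k i = 1" "i \<notin> {c k..c (Suc k)} \<Longrightarrow> K * z k i \<le> 1"
proof -
  have "1 * 1 \<le> real T ^ 2 * (real d + 1)" using T_pos by (intro mult_mono) simp_all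
  then have K1: "K \<ge> 1" by simp
  have down: "(i \<le> c (Suc k) \<longrightarrow> z k i = 1) \<and> (c (Suc k) < i \<longrightarrow> K * z k i \<le> 1)" if "k \<le> \<kappa> i"
    using that
  proof (induction rule: inc_induct)
    case base
    then show ?case using z_\<kappa>[OF i] \<kappa>_block[OF i] by simp
  next
    case (step k)
    have kd: "k < d" using step.hyps \<kappa>_block[OF i] by simp
    have le: "c (Suc k) \<le> i" using c_mono[of "Suc k" "\<kappa> i"] step.hyps \<kappa>_block[OF i] by simp
    have 1: "z (Suc k) i \<le> 1"
    proof (cases "i \<le> c (Suc (Suc k))")
      case False
      have "1 * z (Suc k) i \<le> K * z (Suc k) i" using K1 z_pos[OF i, of "Suc k"] kd by (intro mult_right_mono) auto
      then show ?thesis using step.IH False by simp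
    qed (use step.IH in simp)
    have "K * z k i \<le> 1" if "c (Suc k) < i"
    proof -
      have "K * z k i = z (Suc k) i * (K * \<rho> k i)" unfolding z_step[OF i kd] by simp
      also have "\<dots> \<le> 1 * 1"
        using \<rho>_bounds(2)[OF i kd that] 1 z_pos[OF i, of "Suc k"] z_pos[OF i, of k] z_step[OF i kd] K_pos kd
        by (intro mult_mono) (auto simp: zero_less_mult_iff)
      finally show ?thesis by simp
    qed
    moreover have "z k i = 1" if "i \<le> c (Suc k)"
    proof -
      have eq: "i = c (Suc k)" using that le by simp
      then have "i \<le> c (Suc (Suc k))" using c_mono[of "Suc k" "Suc (Suc k)"] by simp
      then show ?thesis using step.IH \<rho>_bounds(1)[OF i kd eq] z_step[OF i kd] by simp
    qed
    ultimately show ?case by blast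
  qed
  have up: "(c k \<le> i \<longrightarrow> z k i = 1) \<and> (i < c k \<longrightarrow> K * z k i \<le> 1)" if "\<kappa> i \<le> k"
    using that k
  proof (induction rule: dec_induct)
    case base
    then show ?case using z_\<kappa>[OF i] \<kappa>_block[OF i] by simp
  next
    case (step k)
    have kd: "k < d" using step.prems by simp
    have le: "i \<le> c (Suc k)" using c_mono[of "Suc (\<kappa> i)" "Suc k"] step.hyps \<kappa>_block[OF i] by simp
    have IH: "(c k \<le> i \<longrightarrow> z k i = 1) \<and> (i < c k \<longrightarrow> K * z k i \<le> 1)" using step.IH kd by simp
    have 1: "z k i \<le> 1"
    proof (cases "c k \<le> i")
      case False
      have "1 * z k i \<le> K * z k i" using K1 z_pos[OF i, of k] kd by (intro mult_right_mono) auto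
      then show ?thesis using IH False by simp
    qed (use IH in simp)
    have "K * z (Suc k) i \<le> 1" if "i < c (Suc k)"
    proof -
      have "K * z (Suc k) i \<le> \<rho> k i * z (Suc k) i"
        using \<rho>_bounds(3)[OF i kd that] z_pos[OF i, of "Suc k"] kd by (intro mult_right_mono) auto
      also have "\<dots> = z k i" using z_step[OF i kd] by simp
      finally show ?thesis using 1 by simp
    qed
    moreover have "z (Suc k) i = 1" if "c (Suc k) \<le> i"
    proof -
      have eq: "i = c (Suc k)" using that le by simp
      then have "c k \<le> i" using c_mono[of k "Suc k"] by simp
      then show ?thesis using IH \<rho>_bounds(1)[OF i kd eq] z_step[OF i kd] by simp
    qed
    ultimately show ?case by blast
  qed
  have dis: "k \<le> \<kappa> i \<or> \<kappa> i \<le> k" by linarith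
  have "c k \<le> i" if "k \<le> \<kappa> i" using c_mono[OF that] \<kappa>_block[OF i] by simp
  moreover have "i \<le> c (Suc k)" if "\<kappa> i \<le> k"
    using c_mono[of "Suc (\<kappa> i)" "Suc k"] that \<kappa>_block[OF i] by simp
  ultimately show "i \<in> {c k..c (Suc k)} \<Longrightarrow> z k i = 1" "i \<notin> {c k..c (Suc k)} \<Longrightarrow> K * z k i \<le> 1"
    using up down dis by (auto simp: not_le)
qed

text \<open>
  Equating the \<open>k\<close>-th coordinates of the parts of \<open>i\<close> and of \<open>c k\<close>, for \<open>c k < i \<le> c (k + 1)\<close>, gives
  \<open>T - 1\<close> homogeneous equations in \<open>T\<close> unknowns. If only the dominating terms are kept, the solutions
  are the multiples of \<open>a\<close>; by the growth condition all solutions are close to those.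
\<close>

lemma colorful_imp_balanced:
  assumes col: "colorful d r \<I>"
  shows "\<exists>\<alpha> y. (\<forall>i\<in>{1..T}. 0 \<le> \<alpha> i) \<and> balanced \<alpha> y \<and> y 0 > 0"
proof -
  have "\<forall>i\<in>{1..T}. \<exists>J\<in>\<I>. i \<in> J" using I_Un by blast
  then obtain P where P: "\<And>i. i \<in> {1..T} \<Longrightarrow> P i \<in> \<I>" "\<And>i. i \<in> {1..T} \<Longrightarrow> i \<in> P i"
    by metis
  define e where "e i v = (of_bool (v \<in> P i) - of_bool (v \<in> P (c (\<kappa> i)))) * x v (\<kappa> i)" for i v
  have "card {2..T} < card {1..T}" using T_pos by simp
  then obtain g where g_nz: "\<exists>v\<in>{1..T}. g v \<noteq> 0" and g: "\<forall>i\<in>{2..T}. (\<Sum>v\<in>{1..T}. e i v * g v) = 0"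
    using homogeneous_system_nontrivial_solution[of "{2..T}" "{1..T}" e] by auto
  define R where "R J k = (\<Sum>v\<in>J. g v * x v k)" for J k
  have R_sum: "(\<Sum>v\<in>{1..T}. of_bool (v \<in> J) * (g v * x v k)) = R J k" if "J \<in> \<I>" for J k
  proof -
    have "(\<Sum>v\<in>{1..T}. of_bool (v \<in> J) * (g v * x v k)) = (\<Sum>v\<in>J. of_bool (v \<in> J) * (g v * x v k))"
      using I_sub[OF that] by (intro sum.mono_neutral_right) auto
    then show ?thesis by (simp add: R_def)
  qed
  have c_\<kappa>: "c (\<kappa> i) \<in> {1..T}" if "i \<in> {1..T}" for i
    using c_range[of "\<kappa> i"] \<kappa>_block(1)[OF that] by simp
  have R_eq: "R (P i) (\<kappa> i) = R (P (c (\<kappa> i))) (\<kappa> i)" if i: "i \<in> {2..T}" for i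
  proof -
    have i1: "i \<in> {1..T}" using i by simp
    have "0 = (\<Sum>v\<in>{1..T}. e i v * g v)" using g i by simp
    also have "\<dots> = (\<Sum>v\<in>{1..T}. of_bool (v \<in> P i) * (g v * x v (\<kappa> i)) -
        of_bool (v \<in> P (c (\<kappa> i))) * (g v * x v (\<kappa> i)))"
      by (intro sum.cong refl) (simp add: e_def algebra_simps)
    also have "\<dots> = R (P i) (\<kappa> i) - R (P (c (\<kappa> i))) (\<kappa> i)"
      unfolding sum_subtractf R_sum[OF P(1)[OF i1]] R_sum[OF P(1)[OF c_\<kappa>[OF i1]]] ..
    finally show ?thesis by simp
  qed
  \<comment> \<open>Quotient of the true and the approximate solution. Since \<open>a\<close> is
    positive, it suffices to show that all \<open>\<beta> v\<close> have the same sign.\<close>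
  define \<beta> where "\<beta> v = g v / a v" for v
  define m where "m = Max ((\<lambda>v. \<bar>\<beta> v\<bar>) ` {1..T})"
  have m_ge: "\<bar>\<beta> v\<bar> \<le> m" if "v \<in> {1..T}" for v
    unfolding m_def using that by (intro Max_ge) auto
  have "m \<in> (\<lambda>v. \<bar>\<beta> v\<bar>) ` {1..T}" unfolding m_def using T_pos by (intro Max_in) auto
  then obtain w where w: "w \<in> {1..T}" "m = \<bar>\<beta> w\<bar>" by blast
  have m_pos: "m > 0"
  proof -
    obtain v where v: "v \<in> {1..T}" "g v \<noteq> 0" using g_nz by blast
    then have "\<bar>\<beta> v\<bar> > 0" using a_pos[of v] by (simp add: \<beta>_def)
    then show ?thesis using m_ge[OF v(1)] by linarith
  qed
  have R_\<beta>: "R J k = scale k * (\<Sum>v\<in>J. \<beta> v * z k v)" if J: "J \<in> \<I>" and k: "k \<le> d" for J k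
    unfolding R_def sum_distrib_left
  proof (intro sum.cong refl)
    fix v assume "v \<in> J"
    then have "a v > 0" using a_pos[OF I_mem[OF J]] by simp
    then show "g v * x v k = scale k * (\<beta> v * z k v)"
      using scale_pos[OF k] by (simp add: \<beta>_def z_def)
  qed
  \<comment> \<open>By colorfulness \<open>J\<close> meets block \<open>k\<close> only in
    \<open>j\<close>, where \<open>z\<close> is 1; every other term is at most \<open>m / K\<close>
    in absolute value.\<close>
  have near: "\<bar>R J k / scale k - \<beta> j\<bar> \<le> T * m / K"
    if J: "J \<in> \<I>" and k: "k \<le> d" and j: "j \<in> J" "j \<in> {c k..c (Suc k)}" for J k j
  proof -
    have "R J k / scale k = (\<Sum>v\<in>J. \<beta> v * z k v)"
      unfolding R_\<beta>[OF J k] using scale_pos[OF k] by simp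
    also have "\<dots> = \<beta> j * z k j + (\<Sum>v\<in>J - {j}. \<beta> v * z k v)"
      using I_fin[OF J] j(1) by (rule sum.remove)
    also have "z k j = 1" using z_bounds(1)[OF I_mem[OF J j(1)] k j(2)] .
    finally have "R J k / scale k - \<beta> j = (\<Sum>v\<in>J - {j}. \<beta> v * z k v)" by simp
    also have "\<bar>\<dots>\<bar> \<le> (\<Sum>v\<in>J - {j}. \<bar>\<beta> v * z k v\<bar>)" by (rule sum_abs)
    also have "\<dots> \<le> card (J - {j}) * (m / K)"
    proof (rule sum_bounded_above)
      fix v assume v: "v \<in> J - {j}"
      then have vT: "v \<in> {1..T}" using I_mem[OF J] by blast
      have "v \<notin> {c k..c (Suc k)}" using col J j v k unfolding colorful_iff by blast
      then have "z k v \<le> 1 / K" using z_bounds(2)[OF vT k] K_pos by (simp add: field_simps)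
      then have "\<bar>\<beta> v\<bar> * z k v \<le> m * (1 / K)"
        using m_ge[OF vT] z_pos[OF vT k] by (intro mult_mono) auto
      then show "\<bar>\<beta> v * z k v\<bar> \<le> m / K" using z_pos[OF vT k] by (simp add: abs_mult)
    qed
    also have "\<dots> \<le> T * (m / K)"
    proof (rule mult_right_mono)
      show "real (card (J - {j})) \<le> real T"
        using I_card[OF J] card_Diff1_le[of J j] by simp
      show "0 \<le> m / K" using m_pos K_pos by simp
    qed
    finally show ?thesis by simp
  qed
  define \<epsilon> where "\<epsilon> = 2 * (T * m / K)"
  have \<epsilon>_nonneg: "0 \<le> \<epsilon>" using m_pos K_pos by (simp add: \<epsilon>_def)
  have step: "\<bar>\<beta> i - \<beta> (c (\<kappa> i))\<bar> \<le> \<epsilon>" if i: "i \<in> {2..T}" for i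
  proof -
    have i1: "i \<in> {1..T}" using i by simp
    have "c (\<kappa> i) \<in> {c (\<kappa> i)..c (Suc (\<kappa> i))}" using c_mono[of "\<kappa> i" "Suc (\<kappa> i)"] by simp
    from near[OF P(1)[OF c_\<kappa>[OF i1]] \<kappa>_block(1)[OF i1] P(2)[OF c_\<kappa>[OF i1]] this]
    have "\<bar>R (P i) (\<kappa> i) / scale (\<kappa> i) - \<beta> (c (\<kappa> i))\<bar> \<le> T * m / K"
      unfolding R_eq[OF i] .
    moreover have "\<bar>R (P i) (\<kappa> i) / scale (\<kappa> i) - \<beta> i\<bar> \<le> T * m / K"
      using near[OF P(1)[OF i1] \<kappa>_block(1)[OF i1] P(2)[OF i1]] \<kappa>_block(2,3)[OF i1] by simp
    ultimately show ?thesis unfolding \<epsilon>_def by linarith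
  qed
  \<comment> \<open>The chain \<open>i\<close>, \<open>c (\<kappa> i)\<close>, and so on lowers the
    block number each time until it reaches 1. It has at most \<open>\<kappa> i + 1\<close> links,
    each costing \<open>\<epsilon>\<close>.\<close>
  have close: "\<bar>\<beta> i - \<beta> 1\<bar> \<le> (real (\<kappa> i) + 1) * \<epsilon>" if "i \<in> {1..T}" for i
    using that
  proof (induction i rule: less_induct)
    case (less i)
    show ?case
    proof (cases "i = 1")
      case True
      have "0 \<le> (real (\<kappa> i) + 1) * \<epsilon>" by (rule mult_nonneg_nonneg[OF _ \<epsilon>_nonneg]) simp
      then show ?thesis using True by (metis diff_self abs_zero)
    next
      case False
      then have i: "i \<in> {2..T}" "1 < i" "i \<le> T" using less.prems by auto
      let ?c = "c (\<kappa> i)"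
      have "\<bar>\<beta> ?c - \<beta> 1\<bar> \<le> real (\<kappa> i) * \<epsilon>"
      proof (cases "?c = 1")
        case True
        have "0 \<le> real (\<kappa> i) * \<epsilon>" by (rule mult_nonneg_nonneg[OF _ \<epsilon>_nonneg]) simp
        then show ?thesis using True by (metis diff_self abs_zero)
      next
        case False
        then have c: "1 < ?c" "?c \<le> T" using c_\<kappa>[OF less.prems] by auto
        have "\<kappa> ?c < \<kappa> i"
        proof (rule ccontr)
          assume "\<not> \<kappa> ?c < \<kappa> i"
          then show False using c_mono[of "\<kappa> i" "\<kappa> ?c"] \<kappa>_bounds(2)[OF c] by simp
        qed
        then have "(real (\<kappa> ?c) + 1) * \<epsilon> \<le> real (\<kappa> i) * \<epsilon>"
          using \<epsilon>_nonneg by (intro mult_right_mono) auto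
        then show ?thesis
          using less.IH[OF \<kappa>_bounds(2)[OF i(2,3)] c_\<kappa>[OF less.prems]] by linarith
      qed
      then show ?thesis using step[OF i(1)] by (simp add: distrib_right)
    qed
  qed
  have third: "\<bar>\<beta> i - \<beta> 1\<bar> \<le> m / 3" if i: "i \<in> {1..T}" for i
  proof -
    have "(real (\<kappa> i) + 1) * (2 * (T * m / K)) \<le> (real d + 1) * (2 * (T * m / K))"
      using \<kappa>_block(1)[OF i] m_pos by (intro mult_right_mono) auto
    also have "\<dots> = m / (3 * T)"
    proof -
      have "D * (2 * (t * m / (6 * t ^ 2 * D))) = m / (3 * t)" if "t > 0" "D > 0" for t D :: real
        using that by (simp add: power2_eq_square)
      from this[of "real T" "real d + 1"] show ?thesis using T_pos by simp
    qed
    also have "\<dots> \<le> m / 3" using T_pos m_pos by (simp add: field_simps)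
    finally show ?thesis using close[OF i] unfolding \<epsilon>_def by linarith
  qed
  \<comment> \<open>Some \<open>\<beta> w\<close> attains \<open>m\<close>, so
    \<open>\<beta> 1\<close> is too far from 0 for any \<open>\<beta> i\<close> within
    \<open>m / 3\<close> of it to vanish or change sign.\<close>
  have "\<bar>\<beta> 1\<bar> \<ge> 2 * m / 3" using third[OF w(1)] w(2) by linarith
  then have sign: "\<beta> i / \<beta> 1 > 0" if "i \<in> {1..T}" for i
    using third[OF that] m_pos by (auto simp: zero_less_divide_iff abs_if split: if_splits)
  \<comment> \<open>The solution \<open>g\<close> may be negative throughout; dividing by
    \<open>\<beta> 1\<close> corrects the sign.\<close>
  define \<alpha> where "\<alpha> i = g i / \<beta> 1" for i
  have \<alpha>_pos: "\<alpha> i > 0" if i: "i \<in> {1..T}" for i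
  proof -
    have "\<alpha> i = a i * (\<beta> i / \<beta> 1)" using a_pos[OF i] by (simp add: \<alpha>_def \<beta>_def)
    then show ?thesis using mult_pos_pos[OF a_pos[OF i] sign[OF i]] by (simp only:)
  qed
  have \<alpha>_R: "(\<Sum>i\<in>J. \<alpha> i * x i k) = R J k / \<beta> 1" for J k
    by (simp add: R_def \<alpha>_def sum_divide_distrib)
  define y where "y k = R (P (c k)) k / \<beta> 1" for k
  have "balanced \<alpha> y"
    unfolding balanced_def
  proof (intro ballI allI impI)
    fix J k assume J: "J \<in> \<I>" and k: "k \<le> d"
    obtain j where j: "j \<in> {c k..c (Suc k)}" "j \<in> J" using col J k unfolding colorful_iff by blast
    have jT: "j \<in> {1..T}" using I_mem[OF J j(2)] .
    have PJ: "P j = J" using I_disj[OF P(1)[OF jT] J P(2)[OF jT] j(2)] .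
    \<comment> \<open>Index \<open>c k\<close> is the reference of its block, and every other index
      of the block has its own equation.\<close>
    have "R J k = R (P (c k)) k"
    proof (cases "j = c k")
      case True
      then show ?thesis using PJ by simp
    next
      case False
      then have "c k < j" "j \<le> c (Suc k)" "j \<le> T" using j jT by auto
      then have "\<kappa> j = k" "j \<in> {2..T}" using \<kappa>_unique c_range[of k] k by auto
      then show ?thesis using R_eq[of j] PJ by simp
    qed
    then show "(\<Sum>i\<in>J. \<alpha> i * x i k) = y k" unfolding \<alpha>_R y_def by simp
  qed
  moreover have "y 0 > 0"
  proof -
    have 1: "1 \<in> {1..T}" using T_pos by simp
    have "y 0 = (\<Sum>i\<in>P 1. \<alpha> i * x i 0)" unfolding \<alpha>_R y_def c_0 ..
    also have "\<dots> > 0"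
      using I_fin[OF P(1)[OF 1]] I_ne[OF P(1)[OF 1]] \<alpha>_pos pos I_mem[OF P(1)[OF 1]]
      by (intro sum_pos) simp_all
    finally show ?thesis .
  qed
  ultimately show ?thesis using \<alpha>_pos by (intro exI[of _ \<alpha>] exI[of _ y]) (simp add: less_imp_le)
qed

lemma colorful_iff_balanced:
  "colorful d r \<I> \<longleftrightarrow> (\<exists>\<alpha> y. (\<forall>i\<in>{1..T}. 0 \<le> \<alpha> i) \<and> balanced \<alpha> y \<and> y 0 > 0)"
  using colorful_imp_balanced balanced_imp_colorful by blast

end

section \<open>Avoidability\<close>

text \<open>A subsequence is again stretched: as \<open>s\<close> is increasing, all positions of
  point \<open>s j\<close> in \<open>X\<close> precede those of \<open>s i\<close> for
  \<open>j < i\<close>.\<close>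

lemma Tv_iff_colorful:
  fixes X :: "nat \<Rightarrow> real" and \<kappa> :: "'n::finite \<Rightarrow> nat" and r :: nat
  defines "d \<equiv> CARD('n)" and "T \<equiv> tverberg_number CARD('n) r"
  assumes r: "r \<ge> 1" and type: "tverberg_type d r \<I>" and \<kappa>: "bij_betw \<kappa> UNIV {..<d}"
    and X: "fast_growing (6 * real T ^ 2 * (real d + 1)) (Suc n * d) X"
    and s: "strict_mono_on {1..T} s" "s ` {1..T} \<subseteq> {1..n}"
  shows "Tv \<I> ((\<lambda>i. \<chi> j. X (i * d + \<kappa> j)) \<circ> s) \<longleftrightarrow> colorful d r \<I>"
proof -
  define C where "C = 6 * real T ^ 2 * (real d + 1)"
  define x where "x i k = (if k = 0 then 1 else X (s i * d + (k - 1)))" for i k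
  define p where "p = (\<lambda>i. \<chi> j. X (i * d + \<kappa> j)) \<circ> s"
  have p: "p i $ j = x i (Suc (\<kappa> j))" for i j by (simp add: p_def x_def)
  have C: "C \<ge> 0" by (simp add: C_def)
  have idx: "s i * d + k < Suc n * d" if "i \<in> {1..T}" "k < d" for i k
  proof -
    have "s i \<le> n" using s(2) that(1) unfolding image_subset_iff by simp
    then have "s i * d \<le> n * d" by (rule mult_le_mono1)
    then show ?thesis using that(2) unfolding mult_Suc by linarith
  qed
  have ge1: "1 \<le> X m" if "m < Suc n * d" for m
    using X that unfolding fast_growing_def by simp
  have fast: "C * X a * X b < X m" if "m < Suc n * d" "a < m" "b < m" for a b m
    using X that unfolding fast_growing_def C_def by simp
  have x_ge1: "1 \<le> x i k" if "i \<in> {1..T}" "k \<le> d" for i k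
    using ge1[OF idx[OF that(1)]] that(2) by (cases k) (simp_all add: x_def)
  have part: "partition_on {1..T} \<I>" and card: "card \<I> = r"
    using type unfolding tverberg_type_def T_def d_def by simp_all
  interpret stretched d r T \<I> x
  proof
    show "r \<ge> 1" "partition_on {1..T} \<I>" "card \<I> = r" by (fact r part card)+
    show "T = (r - 1) * (d + 1) + 1" by (simp add: T_def d_def tverberg_number_def)
    show "x i k > 0" if "i \<in> {1..T}" "k \<le> d" for i k using x_ge1[OF that] by linarith
    fix i j k assume i: "i \<in> {1..T}" and j: "j \<in> {1..T}" and ji: "j < i" and k: "k < d"
    have "s j < s i" using s(1) i j ji by (simp add: strict_mono_on_def)
    then have "s j * d + d \<le> s i * d" using mult_le_mono1[of "Suc (s j)" "s i" d] by simp
    then have lt: "s j * d + k' < s i * d + k''" if "k' < d" for k' k'' using that by linarith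
    show "6 * real T ^ 2 * (real d + 1) * (x i k * x j (Suc k)) < x i (Suc k) * x j k"
      unfolding C_def[symmetric]
    proof (cases k)
      case 0
      \<comment> \<open>The homogenizing entry \<open>x i 0 = 1\<close> is not a value of
        \<open>X\<close>, so a second factor, at least 1, is inserted to apply
        \<open>fast\<close>.\<close>
      have "C * X (s j * d) * 1 \<le> C * X (s j * d) * X (s j * d)"
        using ge1[OF idx[OF j k]] C 0 by (intro mult_left_mono mult_nonneg_nonneg) auto
      also have "\<dots> < X (s i * d)" using fast[OF idx[OF i k]] lt[OF k, of k] 0 by simp
      finally show "C * (x i k * x j (Suc k)) < x i (Suc k) * x j k" using 0 by (simp add: x_def)
    next
      case (Suc k')
      have "C * (x i k * x j (Suc k)) = C * X (s i * d + k') * X (s j * d + k)"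
        using Suc by (simp add: x_def)
      also have "\<dots> < X (s i * d + k)"
        using fast[OF idx[OF i k], of "s i * d + k'" "s j * d + k"] lt[OF k, of k] Suc by simp
      also have "\<dots> = x i (Suc k) * 1" by (simp add: x_def)
      also have "\<dots> \<le> x i (Suc k) * x j k"
        using x_ge1[OF i, of "Suc k"] x_ge1[OF j, of k] k by (intro mult_left_mono) auto
      finally show "C * (x i k * x j (Suc k)) < x i (Suc k) * x j k" .
    qed
  qed
  have disj: "disjoint \<I>" using part by (simp add: partition_on_def)
  have ne: "\<I> \<noteq> {}" using card r by auto
  have x0: "x i 0 = 1" for i by (simp add: x_def)
  have comp: "(\<Sum>i\<in>J. \<alpha> i *\<^sub>R p i) $ j = (\<Sum>i\<in>J. \<alpha> i * x i (Suc (\<kappa> j)))" for J \<alpha> j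
    by (simp add: p)
  have Tv: "Tv \<I> p \<longleftrightarrow> (\<exists>\<alpha>. (\<forall>i\<in>{1..T}. 0 \<le> \<alpha> i) \<and> (\<forall>J\<in>\<I>. sum \<alpha> J = 1) \<and>
     (\<forall>J\<in>\<I>. \<forall>J'\<in>\<I>. (\<Sum>i\<in>J. \<alpha> i *\<^sub>R p i) = (\<Sum>i\<in>J'. \<alpha> i *\<^sub>R p i)))"
    unfolding I_Un[symmetric] using disj I_fin ne by (rule Tv_iff)
  have "Tv \<I> p \<longleftrightarrow> (\<exists>\<alpha> y. (\<forall>i\<in>{1..T}. 0 \<le> \<alpha> i) \<and> balanced \<alpha> y \<and> y 0 > 0)"
  proof
    assume "Tv \<I> p"
    then obtain \<alpha> where \<alpha>: "\<forall>i\<in>{1..T}. 0 \<le> \<alpha> i" "\<forall>J\<in>\<I>. sum \<alpha> J = 1"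
     "\<forall>J\<in>\<I>. \<forall>J'\<in>\<I>. (\<Sum>i\<in>J. \<alpha> i *\<^sub>R p i) = (\<Sum>i\<in>J'. \<alpha> i *\<^sub>R p i)"
      unfolding Tv by (elim exE conjE) (rule that)
    obtain J0 where J0: "J0 \<in> \<I>" using ne by blast
    define y where "y k = (\<Sum>i\<in>J0. \<alpha> i * x i k)" for k
    have "(\<Sum>i\<in>J. \<alpha> i * x i k) = y k" if J: "J \<in> \<I>" and k: "k \<le> d" for J k
    proof (cases k)
      case 0
      then show ?thesis using bspec[OF \<alpha>(2) J] bspec[OF \<alpha>(2) J0] by (simp add: y_def x0)
    next
      case (Suc k')
      then have "k' \<in> range \<kappa>" using k \<kappa> by (simp add: bij_betw_def)
      then obtain j where j: "k' = \<kappa> j" by blast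
      have "(\<Sum>i\<in>J. \<alpha> i *\<^sub>R p i) = (\<Sum>i\<in>J0. \<alpha> i *\<^sub>R p i)" by (rule bspec[OF bspec[OF \<alpha>(3) J] J0])
      then have "(\<Sum>i\<in>J. \<alpha> i *\<^sub>R p i) $ j = (\<Sum>i\<in>J0. \<alpha> i *\<^sub>R p i) $ j" by (rule arg_cong)
      then show ?thesis unfolding comp y_def Suc j .
    qed
    then have "balanced \<alpha> y" unfolding balanced_def by blast
    moreover have "y 0 > 0" using bspec[OF \<alpha>(2) J0] by (simp add: y_def x0)
    ultimately show "\<exists>\<alpha> y. (\<forall>i\<in>{1..T}. 0 \<le> \<alpha> i) \<and> balanced \<alpha> y \<and> y 0 > 0"
      using \<alpha>(1) by (intro exI[of _ \<alpha>] exI[of _ y] conjI)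
  next
    assume "\<exists>\<alpha> y. (\<forall>i\<in>{1..T}. 0 \<le> \<alpha> i) \<and> balanced \<alpha> y \<and> y 0 > 0"
    then obtain \<alpha> y where \<alpha>: "\<forall>i\<in>{1..T}. 0 \<le> \<alpha> i" and bal: "balanced \<alpha> y" and y0: "y 0 > 0"
      by (elim exE conjE) (rule that)
    \<comment> \<open>Dividing by the common total weight \<open>y 0\<close> turns the weights into
      convex coefficients.\<close>
    define \<beta> where "\<beta> i = \<alpha> i / y 0" for i
    have \<beta>: "(\<Sum>i\<in>J. \<beta> i * x i k) = y k / y 0" if "J \<in> \<I>" "k \<le> d" for J k
      using bal that unfolding balanced_def \<beta>_def by (simp flip: sum_divide_distrib)
    have "sum \<beta> J = 1" if "J \<in> \<I>" for J using \<beta>[OF that, of 0] y0 by (simp add: x0)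
    moreover have "(\<Sum>i\<in>J. \<beta> i *\<^sub>R p i) = (\<Sum>i\<in>J'. \<beta> i *\<^sub>R p i)" if "J \<in> \<I>" "J' \<in> \<I>" for J J'
    proof -
      have "Suc (\<kappa> j) \<le> d" for j using bij_betwE[OF \<kappa>] by (simp add: Suc_le_eq)
      then show ?thesis unfolding vec_eq_iff comp using \<beta> that by simp
    qed
    moreover have "0 \<le> \<beta> i" if "i \<in> {1..T}" for i using bspec[OF \<alpha> that] y0 by (simp add: \<beta>_def)
    ultimately show "Tv \<I> p" unfolding Tv by (intro exI[of _ \<beta>] conjI ballI)
  qed
  then show ?thesis unfolding colorful_iff_balanced p_def .
qed

lemma exists_generic_Tv_iff_colorful:
  fixes b :: "((nat \<Rightarrow> real ^ 'n::finite) \<Rightarrow> real) bool_comb" and r :: nat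
  defines "T \<equiv> tverberg_number CARD('n) r"
  assumes r: "r \<ge> 1" and type: "tverberg_type CARD('n) r \<I>" and b: "given_by T b \<Phi>"
  shows "\<exists>P. generic T b n P \<and> (\<forall>s. strict_mono_on {1..T} s \<longrightarrow> s ` {1..T} \<subseteq> {1..n} \<longrightarrow>
    (Tv \<I> (P \<circ> s) \<longleftrightarrow> colorful CARD('n) r \<I>))"
proof -
  obtain \<kappa> :: "'n \<Rightarrow> nat" where \<kappa>: "bij_betw \<kappa> UNIV {..<CARD('n)}"
    using ex_bij_betw_finite_nat[of "UNIV :: 'n set"] by (auto simp: atLeast0LessThan)
  have atoms: "tuple_polynomial T f \<and> f \<noteq> (\<lambda>p. 0)" if "f \<in> atoms b" for f
    using b that by (simp add: given_by_def)
  have "\<exists>X. fast_growing (6 * real T ^ 2 * (real CARD('n) + 1)) (Suc n * CARD('n)) X \<and>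
      generic T b n (\<lambda>i. \<chi> j. X (i * CARD('n) + \<kappa> j))"
    by (rule exists_fast_growing_generic[OF \<kappa> atoms])
  then obtain X where X: "fast_growing (6 * real T ^ 2 * (real CARD('n) + 1)) (Suc n * CARD('n)) X"
    and gen: "generic T b n (\<lambda>i. \<chi> j. X (i * CARD('n) + \<kappa> j))"
    by (elim exE conjE) (rule that)
  have "Tv \<I> ((\<lambda>i. \<chi> j. X (i * CARD('n) + \<kappa> j)) \<circ> s) \<longleftrightarrow> colorful CARD('n) r \<I>"
    if "strict_mono_on {1..T} s" "s ` {1..T} \<subseteq> {1..n}" for s
    using Tv_iff_colorful[OF r type \<kappa> X[unfolded T_def] that[unfolded T_def]] .
  with gen show ?thesis by (intro exI[of _ "\<lambda>i. \<chi> j. X (i * CARD('n) + \<kappa> j)"]) blast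
qed

theorem theorem1p2:
  fixes r :: nat and \<I> :: "nat set set"
  assumes "r \<ge> 1"
    and "tverberg_type CARD('n::finite) r \<I>"
  shows "(colorful CARD('n) r \<I> \<longrightarrow>
            avoidable (tverberg_number CARD('n) r) (\<lambda>p :: nat \<Rightarrow> real ^ 'n. \<not> Tv \<I> p)) \<and>
         (\<not> colorful CARD('n) r \<I> \<longrightarrow>
            avoidable (tverberg_number CARD('n) r) (\<lambda>p :: nat \<Rightarrow> real ^ 'n. Tv \<I> p))"
proof -
  define T where "T = tverberg_number CARD('n) r"
  have "\<I> \<noteq> {}" "partition_on {1..T} \<I>"
    using assms by (auto simp: tverberg_type_def T_def)
  then have sa: "semialgebraic T (\<lambda>p :: nat \<Rightarrow> real ^ 'n. Tv \<I> p)"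
    using semialgebraic_Tv by blast
  \<comment> \<open>The condition on \<open>\<Phi>\<close> covers both halves: it holds for the
    negated predicate if the type is colorful and for the predicate itself if not.\<close>
  have avoid: "\<not> unavoidable_wrt T b \<Phi>"
    if b: "given_by T b \<Phi>" and \<Phi>: "\<And>p. \<Phi> p \<Longrightarrow> Tv \<I> p \<noteq> colorful CARD('n) r \<I>"
    for b and \<Phi> :: "(nat \<Rightarrow> real ^ 'n) \<Rightarrow> bool"
  proof
    assume "unavoidable_wrt T b \<Phi>"
    then obtain N where N: "\<forall>n\<ge>N. \<forall>P. generic T b n P \<longrightarrow> occurs T \<Phi> n P"
      unfolding unavoidable_wrt_def ..
    obtain P where P: "generic T b N P" "\<forall>s. strict_mono_on {1..T} s \<longrightarrow> s ` {1..T} \<subseteq> {1..N} \<longrightarrow>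
        (Tv \<I> (P \<circ> s) \<longleftrightarrow> colorful CARD('n) r \<I>)"
      using exists_generic_Tv_iff_colorful[OF assms b[unfolded T_def], of N, folded T_def]
      by (elim exE conjE) (rule that)
    have "occurs T \<Phi> N P" using N P(1) by simp
    then obtain s where "strict_mono_on {1..T} s" "s ` {1..T} \<subseteq> {1..N}" "\<Phi> (P \<circ> s)"
      unfolding occurs_def by (elim exE conjE) (rule that)
    then show False using P(2) \<Phi>[of "P \<circ> s"] by simp
  qed
  show ?thesis
    using sa semialgebraic_not[OF sa] avoid unfolding avoidable_def T_def[symmetric] by simp
qed

end
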